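(* Let $\alpha\in(0,1)$ and let $(\mu_t)_{t\ge 0}$ be Frozen-Boundary Diffusion with parameter $\alpha$, with boundary $\beta_t$ and rescaled measures $\tilde\mu_t$. Assume that $\lim_{t\to\infty}\beta_t/\sqrt{t}$ exists and is a (finite) constant. Then there is a unique positive number $q_\alpha$ such that $$\frac{\alpha}{2}\,q_\alpha=\frac{(1-\alpha)\,e^{-q_\alpha^2/2}}{\sqrt{2\pi}\;\Phi([-q_\alpha,q_\alpha])},$$ and, as $t\to\infty$, $\tilde\mu_t$ converges weakly to the probability measure $$\mu_\infty(\alpha)=\frac{\alpha}{2}\,\delta(-q_\alpha)+(1-\alpha)\,\Phi_{q_\alpha}+\frac{\alpha}{2}\,\delta(q_\alpha).$$
   Context: Fix $\alpha\in(0,1)$. Frozen-Boundary Diffusion with parameter $\alpha$ is the deterministic sequence $(\mu_t)_{t=0,1,2,\ldots}$ of symmetric probability distributions on $\mathbb{Z}$ defined recursively as follows. Let $\mu_0=\delta(0)$ be the unit point mass at $0$. Given $\mu_t$, the boundary is $$\beta_t:=\sup\{x\in\mathbb{Z}:\ \mu_t([x,\infty))\ge \tfrac{\alpha}{2}\}.$$ The frozen mass $f_t$ consists of the leftmost mass $\alpha/2$ and the rightmost mass $\alpha/2$ of $\mu_t$. Explicitly, if $\beta_t>0$, then for $y\ge 0$ $$f_t(y)=\begin{cases}\mu_t(y), & y>\beta_t,\\ \frac{\alpha}{2}-\sum_{z>\beta_t}\mu_t(z), & y=\beta_t,\\ 0, & 0\le y<\beta_t,\end{cases}$$ and $f_t(y)=f_t(-y)$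 for $y<0$. If $\beta_t=0$, then $f_t(y)=\mu_t(y)$ for $y\neq 0$ and $f_t(0)=\alpha-2\sum_{z>0}\mu_t(z)$ (contributions from both sides). Thus $f_t$ has total mass $\alpha$. The free mass is $\nu_t:=\mu_t-f_t$, of total mass $1-\alpha$. The next distribution is $$\mu_{t+1}(x)=\frac{\nu_t(x-1)+\nu_t(x+1)}{2}+f_t(x),\qquad x\in\mathbb{Z}.$$ Viewing $\mu_t$ as a measure on $\mathbb{R}$, for $t\ge 1$ the rescaled measure $\tilde\mu_t$ is the Borel probability measure on $\mathbb{R}$ given by $\tilde\mu_t(A)=\mu_t(\{y\sqrt{t}: y\in A\})$ for Borel sets $A$. $\Phi$ denotes the standard Gaussian measure on $\mathbb{R}$. For $q>0$, $\Phi_q$ is the probability measure supported on $[-q,q]$ whose density is the standard Gaussian density restricted to $[-q,q]$ and normalized to have integral $1$. $\delta(x)$ denotes the unit point mass at $x$. *)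

theory Defs
  imports "HOL-Probability.Probability"
begin

text \<open>
  A (finite) measure on the integers is represented by its mass function \<open>m :: int \<Rightarrow> real\<close>.
\<close>

definition tail_mass :: "(int \<Rightarrow> real) \<Rightarrow> int \<Rightarrow> real" where
  "tail_mass m x = (\<Sum>\<^sub>\<infinity>y\<in>{x..}. m y)"

definition boundary :: "real \<Rightarrow> (int \<Rightarrow> real) \<Rightarrow> int" where
  "boundary \<alpha> m = Sup {x. tail_mass m x \<ge> \<alpha> / 2}"

text \<open>
  For the symmetric probability distributions of the diffusion the boundary is never negative
  (lemma \<open>boundary_nonneg\<close> below), so the \<open>else\<close> branch is the case of boundary \<open>0\<close>, in which the
  site \<open>0\<close> contributes to the frozen mass of both sides.
\<close>

definition frozen :: "real \<Rightarrow> (int \<Rightarrow> real) \<Rightarrow> int \<Rightarrow> real" where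
  "frozen \<alpha> m y =
     (let b = boundary \<alpha> m in
      if b > 0 then
        (if \<bar>y\<bar> > b then m \<bar>y\<bar>
         else if \<bar>y\<bar> = b then \<alpha> / 2 - (\<Sum>\<^sub>\<infinity>z\<in>{b<..}. m z)
         else 0)
      else
        (if y \<noteq> 0 then m y else \<alpha> - 2 * (\<Sum>\<^sub>\<infinity>z\<in>{0<..}. m z)))"

definition free :: "real \<Rightarrow> (int \<Rightarrow> real) \<Rightarrow> int \<Rightarrow> real" where
  "free \<alpha> m y = m y - frozen \<alpha> m y"

definition fbd_step :: "real \<Rightarrow> (int \<Rightarrow> real) \<Rightarrow> int \<Rightarrow> real" where
  "fbd_step \<alpha> m x = (free \<alpha> m (x - 1) + free \<alpha> m (x + 1)) / 2 + frozen \<alpha> m x"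

primrec fbd :: "real \<Rightarrow> nat \<Rightarrow> int \<Rightarrow> real" where
  "fbd \<alpha> 0 = (\<lambda>x. if x = 0 then 1 else 0)"
| "fbd \<alpha> (Suc t) = fbd_step \<alpha> (fbd \<alpha> t)"

definition fbd_boundary :: "real \<Rightarrow> nat \<Rightarrow> int" where
  "fbd_boundary \<alpha> t = boundary \<alpha> (fbd \<alpha> t)"

definition fbd_measure :: "real \<Rightarrow> nat \<Rightarrow> int measure" where
  "fbd_measure \<alpha> t = density (count_space UNIV) (\<lambda>x. ennreal (fbd \<alpha> t x))"

text \<open>
  Only \<open>t \<ge> 1\<close> is meaningful here. Lemma \<open>emeasure_fbd_rescaled\<close> identifies the push-forward with
  the description by the scaled sets \<open>{y * sqrt t | y \<in> A}\<close>.
\<close>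

definition fbd_rescaled :: "real \<Rightarrow> nat \<Rightarrow> real measure" where
  "fbd_rescaled \<alpha> t = distr (fbd_measure \<alpha> t) borel (\<lambda>x. real_of_int x / sqrt (real t))"

definition std_gaussian :: "real measure" where
  "std_gaussian = density lborel (\<lambda>x. ennreal (std_normal_density x))"

definition trunc_gaussian :: "real \<Rightarrow> real measure" where
  "trunc_gaussian q =
     density lborel (\<lambda>x. ennreal (indicator {-q..q} x * std_normal_density x / measure std_gaussian {-q..q}))"

definition fbd_limit :: "real \<Rightarrow> real \<Rightarrow> real measure" where
  "fbd_limit \<alpha> q = measure_of UNIV (sets borel)
     (\<lambda>A. ennreal (\<alpha> / 2) * emeasure (return borel (-q)) A
        + ennreal (1 - \<alpha>) * emeasure (trunc_gaussian q) A
        + ennreal (\<alpha> / 2) * emeasure (return borel q) A)"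


subsection \<open>The measures are probability measures\<close>

lemma sets_trunc_gaussian [simp, measurable_cong]: "sets (trunc_gaussian q) = sets borel"
  by (simp add: trunc_gaussian_def)

lemma sets_fbd_limit [simp, measurable_cong]: "sets (fbd_limit \<alpha> q) = sets borel"
  unfolding fbd_limit_def by (metis sets_measure_of space_borel sets.sigma_sets_eq sets.space_closed)

lemma space_fbd_limit [simp]: "space (fbd_limit \<alpha> q) = UNIV"
  using sets_eq_imp_space_eq[OF sets_fbd_limit] by simp

lemma emeasure_fbd_limit:
  assumes A: "A \<in> sets borel"
  shows "emeasure (fbd_limit \<alpha> q) A =
           ennreal (\<alpha> / 2) * indicator A (-q) + ennreal (1 - \<alpha>) * emeasure (trunc_gaussian q) A
         + ennreal (\<alpha> / 2) * indicator A q"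
proof -
  let ?\<mu> = "\<lambda>A. ennreal (\<alpha> / 2) * emeasure (return borel (-q)) A
        + ennreal (1 - \<alpha>) * emeasure (trunc_gaussian q) A
        + ennreal (\<alpha> / 2) * emeasure (return borel q) A"
  have "emeasure (fbd_limit \<alpha> q) A = ?\<mu> A"
  proof (rule emeasure_measure_of[OF fbd_limit_def])
    show "positive (sets (fbd_limit \<alpha> q)) ?\<mu>"
      by (simp add: positive_def)
    show "countably_additive (sets (fbd_limit \<alpha> q)) ?\<mu>"
    proof (rule countably_additiveI)
      fix B :: "nat \<Rightarrow> real set"
      assume B: "range B \<subseteq> sets (fbd_limit \<alpha> q)" "disjoint_family B"
      have "(\<Sum>i. emeasure M (B i)) = emeasure M (\<Union>i. B i)"
        if "sets M = sets borel" for M :: "real measure"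
        using B that by (intro suminf_emeasure) auto
      then show "(\<Sum>i. ?\<mu> (B i)) = ?\<mu> (\<Union>i. B i)"
        by (simp add: suminf_add[symmetric] ennreal_suminf_cmult)
    qed
  qed (use A in auto)
  with A show ?thesis by simp
qed

lemma sets_std_gaussian [simp, measurable_cong]: "sets std_gaussian = sets borel"
  by (simp add: std_gaussian_def)

lemma prob_space_std_gaussian: "prob_space std_gaussian"
  unfolding std_gaussian_def by (rule prob_space_normal_density) simp

lemma measure_std_gaussian_pos:
  assumes "q > 0"
  shows "measure std_gaussian {-q..q} > 0"
proof -
  interpret prob_space std_gaussian by (rule prob_space_std_gaussian)
  have "emeasure std_gaussian {-q..q} \<noteq> 0"
  proof
    assume "emeasure std_gaussian {-q..q} = 0"
    then have "AE x in lborel. x \<in> {-q..q} \<longrightarrow> ennreal (std_normal_density x) = 0"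
      by (subst (asm) std_gaussian_def, subst (asm) emeasure_density)
        (auto simp: nn_integral_0_iff_AE indicator_def elim!: eventually_mono split: if_splits)
    then have "AE x in lborel. x \<notin> {-q..q}"
      by eventually_elim (metis ennreal_eq_0_iff normal_density_pos not_le zero_less_one)
    then have "emeasure lborel {-q..q} = 0"
      by (subst (asm) AE_iff_measurable[where N = "{-q..q}"]) auto
    with assms show False by simp
  qed
  then show ?thesis
    by (simp add: emeasure_eq_measure zero_less_measure_iff)
qed

lemma emeasure_trunc_gaussian_UNIV:
  assumes "q > 0"
  shows "emeasure (trunc_gaussian q) UNIV = 1"
proof -
  interpret prob_space std_gaussian by (rule prob_space_std_gaussian)
  let ?Z = "measure std_gaussian {-q..q}"
  have Z: "?Z > 0" using assms by (rule measure_std_gaussian_pos)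
  have "emeasure (trunc_gaussian q) UNIV
      = (\<integral>\<^sup>+x. ennreal (1 / ?Z) * (ennreal (std_normal_density x) * indicator {-q..q} x) \<partial>lborel)"
    unfolding trunc_gaussian_def using Z
    by (subst emeasure_density)
      (auto intro!: nn_integral_cong simp: indicator_def ennreal_mult[symmetric] split: if_splits)
  also have "\<dots> = ennreal (1 / ?Z) * emeasure std_gaussian {-q..q}"
    by (subst nn_integral_cmult) (auto simp: std_gaussian_def emeasure_density)
  also have "\<dots> = 1"
    using Z by (simp add: emeasure_eq_measure ennreal_mult[symmetric])
  finally show ?thesis .
qed

lemma real_distribution_fbd_limit:
  assumes "0 < \<alpha>" "\<alpha> < 1" "q > 0"
  shows "real_distribution (fbd_limit \<alpha> q)"
proof -
  have "emeasure (fbd_limit \<alpha> q) UNIV = ennreal (\<alpha> / 2) + ennreal (1 - \<alpha>) + ennreal (\<alpha> / 2)"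
    using assms by (subst emeasure_fbd_limit) (auto simp: emeasure_trunc_gaussian_UNIV)
  also have "\<dots> = 1"
    using assms by (simp add: ennreal_plus[symmetric] del: ennreal_plus)
  finally have "prob_space (fbd_limit \<alpha> q)"
    by (intro prob_spaceI) simp
  then show ?thesis
    by (simp add: real_distribution_def real_distribution_axioms_def)
qed

definition sym_dist :: "int \<Rightarrow> (int \<Rightarrow> real) \<Rightarrow> bool" where
  "sym_dist n m \<longleftrightarrow> 0 \<le> n \<and> (\<forall>x. 0 \<le> m x) \<and> (\<forall>x. m (-x) = m x) \<and> (\<forall>x. \<bar>x\<bar> > n \<longrightarrow> m x = 0)
     \<and> sum m {-n..n} = 1"

lemma infsum_eq_sum:
  fixes m :: "int \<Rightarrow> real"
  assumes "finite B" "B \<subseteq> A" "\<And>x. x \<in> A - B \<Longrightarrow> m x = 0"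
  shows "infsum m A = sum m B"
proof -
  have "infsum m A = infsum m B"
    by (rule infsum_cong_neutral) (use assms in auto)
  with assms show ?thesis by simp
qed

context
  fixes n :: int and m :: "int \<Rightarrow> real" and \<alpha> :: real
  assumes m: "sym_dist n m" and \<alpha>: "0 < \<alpha>" "\<alpha> < 1"
begin

lemma tail_mass_eq: "tail_mass m x = sum m {x..n}"
  unfolding tail_mass_def by (rule infsum_eq_sum) (use m in \<open>auto simp: sym_dist_def\<close>)

lemma tail_mass_rec: "tail_mass m x = m x + tail_mass m (x + 1)"
proof (cases "x \<le> n")
  case True
  then have "{x..n} = insert x {x+1..n}" by auto
  then show ?thesis by (simp add: tail_mass_eq)
next
  case False
  with m show ?thesis by (simp add: tail_mass_eq sym_dist_def)
qed

lemma infsum_greaterThan_eq: "infsum m {x<..} = tail_mass m (x + 1)"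
  unfolding tail_mass_def by (rule arg_cong[of _ _ "infsum m"]) auto

lemma tail_mass_0: "tail_mass m 0 + tail_mass m 1 = 1"
proof -
  have "1 = sum m ({-n..-1} \<union> {0..n})"
  proof -
    have "{-n..-1} \<union> {0..n} = {-n..n}" using m by (auto simp: sym_dist_def)
    with m show ?thesis by (simp add: sym_dist_def)
  qed
  also have "\<dots> = sum m {-n..-1} + tail_mass m 0"
    by (subst sum.union_disjoint) (auto simp: tail_mass_eq)
  also have "sum m {-n..-1} = tail_mass m 1"
    unfolding tail_mass_eq
    by (rule sum.reindex_bij_witness[of _ uminus uminus]) (use m in \<open>auto simp: sym_dist_def\<close>)
  finally show ?thesis by simp
qed

lemma tail_mass_antimono: "x \<le> y \<Longrightarrow> tail_mass m y \<le> tail_mass m x"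
  unfolding tail_mass_eq by (rule sum_mono2) (use m in \<open>auto simp: sym_dist_def\<close>)

lemma tail_mass_boundary: "tail_mass m (boundary \<alpha> m) \<ge> \<alpha> / 2"
  and tail_mass_gt_boundary: "x > boundary \<alpha> m \<Longrightarrow> tail_mass m x < \<alpha> / 2"
  and boundary_nonneg: "boundary \<alpha> m \<ge> 0"
  and boundary_le: "boundary \<alpha> m \<le> n"
proof -
  let ?S = "{x. tail_mass m x \<ge> \<alpha> / 2}"
  have le: "x \<le> n" if "x \<in> ?S" for x
    using that \<alpha> by (cases "x \<le> n") (auto simp: tail_mass_eq)
  then have bdd: "bdd_above ?S" by (intro bdd_aboveI[of _ n]) auto
  have 0: "0 \<in> ?S"
    using tail_mass_0 tail_mass_antimono[of 0 1] \<alpha> by auto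
  let ?F = "?S \<inter> {0..n}"
  have F: "finite ?F" "0 \<in> ?F" using 0 m by (auto simp: sym_dist_def)
  have Max: "Max ?F \<in> ?F" using F by (intro Max_in) auto
  have "Sup ?S = Max ?F"
  proof (rule cSup_eq_maximum)
    show "Max ?F \<in> ?S" using Max by blast
    fix x assume x: "x \<in> ?S"
    show "x \<le> Max ?F"
    proof (cases "0 \<le> x")
      case True
      with x le F show ?thesis by (intro Max_ge) auto
    next
      case False
      with Max show ?thesis by auto
    qed
  qed
  with Max have "Sup ?S \<in> ?S" by simp
  then show "tail_mass m (boundary \<alpha> m) \<ge> \<alpha> / 2" "boundary \<alpha> m \<le> n"
    using le by (auto simp: boundary_def)
  show "boundary \<alpha> m \<ge> 0"
    unfolding boundary_def using 0 bdd by (rule cSup_upper)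
  show "tail_mass m x < \<alpha> / 2" if "x > boundary \<alpha> m"
    using that cSup_upper[OF _ bdd, of x] by (auto simp: boundary_def not_le[symmetric])
qed

lemma frozen_nonneg: "0 \<le> frozen \<alpha> m y"
  using m \<alpha> tail_mass_gt_boundary[of "boundary \<alpha> m + 1"] boundary_nonneg
  by (auto simp: frozen_def Let_def sym_dist_def infsum_greaterThan_eq)

lemma frozen_le: "frozen \<alpha> m y \<le> m y"
proof -
  have abs: "m \<bar>y\<bar> = m y" using m by (auto simp: sym_dist_def abs_if)
  show ?thesis
    using m \<alpha> abs tail_mass_boundary boundary_nonneg tail_mass_rec[of "boundary \<alpha> m"]
      tail_mass_rec[of 0] tail_mass_0
    by (auto simp: frozen_def Let_def sym_dist_def infsum_greaterThan_eq)
qed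

lemma frozen_minus: "frozen \<alpha> m (-y) = frozen \<alpha> m y"
  using m by (simp add: frozen_def sym_dist_def Let_def)

lemma sym_dist_fbd_step: "sym_dist (n + 1) (fbd_step \<alpha> m)"
proof -
  let ?g = "free \<alpha> m" and ?f = "frozen \<alpha> m"
  have n: "0 \<le> n" using m by (simp add: sym_dist_def)
  have g: "0 \<le> ?g x" "?g (-x) = ?g x" for x
    using frozen_le[of x] m by (auto simp: free_def frozen_minus sym_dist_def)
  have z: "?f x = 0" "?g x = 0" if "\<bar>x\<bar> > n" for x
    using frozen_le[of x] frozen_nonneg[of x] m that by (auto simp: free_def sym_dist_def)
  have sym: "fbd_step \<alpha> m (-x) = fbd_step \<alpha> m x" for x
    using g(2)[of "x + 1"] g(2)[of "x - 1"] by (simp add: fbd_step_def frozen_minus)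
  have shift1: "(\<Sum>x=-(n+1)..n+1. ?g (x - 1)) = sum ?g {-n..n}"
  proof -
    have "(\<Sum>x=-(n+1)..n+1. ?g (x - 1)) = sum ?g {-n-2..n}"
      by (rule sum.reindex_bij_witness[of _ "\<lambda>x. x + 1" "\<lambda>x. x - 1"]) auto
    also have "\<dots> = sum ?g {-n..n}" by (rule sum.mono_neutral_right) (auto intro!: z)
    finally show ?thesis .
  qed
  have shift2: "(\<Sum>x=-(n+1)..n+1. ?g (x + 1)) = sum ?g {-n..n}"
  proof -
    have "(\<Sum>x=-(n+1)..n+1. ?g (x + 1)) = sum ?g {-n..n+2}"
      by (rule sum.reindex_bij_witness[of _ "\<lambda>x. x - 1" "\<lambda>x. x + 1"]) auto
    also have "\<dots> = sum ?g {-n..n}" by (rule sum.mono_neutral_right) (auto intro!: z)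
    finally show ?thesis .
  qed
  have "sum ?f {-(n+1)..n+1} = sum ?f {-n..n}"
    by (rule sum.mono_neutral_right) (auto intro!: z)
  then have "sum (fbd_step \<alpha> m) {-(n+1)..n+1} = sum ?g {-n..n} + sum ?f {-n..n}"
    using shift1 shift2 by (simp add: fbd_step_def sum.distrib flip: sum_divide_distrib)
  also have "\<dots> = 1"
    using m by (simp add: free_def sym_dist_def flip: sum.distrib)
  finally show ?thesis
    using n g(1) frozen_nonneg sym z
    by (auto simp: sym_dist_def fbd_step_def)
qed

end

lemma sym_dist_fbd:
  assumes "0 < \<alpha>" "\<alpha> < 1"
  shows "sym_dist (int t) (fbd \<alpha> t)"
proof (induction t)
  case 0
  show ?case by (auto simp: sym_dist_def)
next
  case (Suc t)
  then show ?case
    using sym_dist_fbd_step[OF Suc assms] by (simp add: add.commute)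
qed

lemma prob_space_fbd_measure:
  assumes "0 < \<alpha>" "\<alpha> < 1"
  shows "prob_space (fbd_measure \<alpha> t)"
proof (rule prob_spaceI)
  note * = sym_dist_fbd[OF assms, of t]
  have "emeasure (fbd_measure \<alpha> t) (space (fbd_measure \<alpha> t))
      = (\<integral>\<^sup>+x. ennreal (fbd \<alpha> t x) \<partial>count_space UNIV)"
    by (simp add: fbd_measure_def emeasure_density)
  also have "\<dots> = (\<Sum>x\<in>{-int t..int t}. ennreal (fbd \<alpha> t x))"
    using * by (intro nn_integral_count_space'[where A = "{-int t..int t}"])
      (force simp: sym_dist_def)+
  also have "\<dots> = 1"
    using * by (subst sum_ennreal) (auto simp: sym_dist_def)
  finally show "emeasure (fbd_measure \<alpha> t) (space (fbd_measure \<alpha> t)) = 1" .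
qed

lemma real_distribution_fbd_rescaled:
  assumes "0 < \<alpha>" "\<alpha> < 1"
  shows "real_distribution (fbd_rescaled \<alpha> t)"
proof -
  interpret prob_space "fbd_measure \<alpha> t" by (rule prob_space_fbd_measure[OF assms])
  show ?thesis
    unfolding fbd_rescaled_def
    by (rule real_distribution_distr) (simp add: fbd_measure_def)
qed

lemma emeasure_fbd_rescaled:
  assumes "t \<ge> 1" "A \<in> sets borel"
  shows "emeasure (fbd_rescaled \<alpha> t) A
       = emeasure (fbd_measure \<alpha> t) {x. real_of_int x \<in> (\<lambda>y. y * sqrt (real t)) ` A}"
proof -
  have "(real_of_int x / sqrt (real t) \<in> A) = (real_of_int x \<in> (\<lambda>y. y * sqrt (real t)) ` A)" for x
    using assms(1) by (auto simp: image_iff field_simps intro!: bexI[of _ "real_of_int x / sqrt (real t)"])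
  then show ?thesis
    unfolding fbd_rescaled_def using assms(2)
    by (subst emeasure_distr) (auto simp: fbd_measure_def intro!: arg_cong2[where f = emeasure])
qed

end

theory Submission
  imports Defs "HOL-Real_Asymp.Real_Asymp"
begin

text \<open>
  The proof is by the method of moments. A step of the diffusion adds half the discrete Laplacian of
  the free mass, so for every test function \<open>g\<close> on the integers the increment of
  \<open>\<Sum>x. \<mu>\<^sub>t x * g x\<close> is the integral of half the second difference of \<open>g\<close> against the free mass
  \<open>\<nu>\<^sub>t\<close> (lemma \<open>sum_fbd_step\<close>). For \<open>g x = x ^ (n + 2)\<close> half the second difference is
  \<open>((n + 2) choose 2) * x ^ n\<close> up to lower order.

  Only mass at the boundary can leave \<open>[-\<beta>\<^sub>t, \<beta>\<^sub>t]\<close>, and it moves by one site only. Since moreover the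
  boundary never moves inwards, \<open>\<mu>\<^sub>t\<close> never charges a site at distance more than \<open>\<beta>\<^sub>t + 1\<close> from \<open>0\<close>
  (lemma \<open>fbd_support\<close>), and the frozen mass sits within distance one of \<open>\<plusminus>\<beta>\<^sub>t\<close>. If
  \<open>\<beta>\<^sub>t / sqrt t\<close> tends to \<open>c\<close>, the rescaled frozen mass therefore has moments tending to
  \<open>\<alpha> * c ^ (2 * k)\<close>, and summing the increments in time shows that the rescaled even moments of
  \<open>\<mu>\<^sub>t\<close> converge to the solution of
  \<open>m 0 = 1\<close>, \<open>m (k + 1) = (2 * k + 1) * (m k - \<alpha> * c ^ (2 * k))\<close>
  (lemma \<open>fbd_moment_even_limit\<close>). In particular \<open>1 - \<alpha> = m 1 \<le> c\<^sup>2\<close>, so \<open>c > 0\<close>.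

  Integration by parts gives the moments of the candidate limit with \<open>q = c\<close> the same recursion with an
  additional term \<open>e * c ^ (2 * k + 2)\<close>, where \<open>e\<close> is the defect of the equation for \<open>q\<close> at \<open>c\<close>.
  The factor \<open>2 * k + 1\<close> in the recursion would blow up such a defect beyond \<open>c ^ (2 * k)\<close>, whereas
  both moment sequences stay below \<open>c ^ (2 * k)\<close>, their measures living on \<open>[-c, c]\<close>. Hence \<open>e = 0\<close>
  (lemma \<open>flux_balance\<close>): the number \<open>c\<close> solves the equation, and all moments
  converge to those of the candidate limit. Uniqueness of the solution is monotonicity, and
  Weierstrass approximation on a compact interval passes from polynomials to continuous test functions.
\<close>

section \<open>Power growth from increments\<close>

text \<open>
  The Stolz--Cesaro theorem. Subtracting \<open>L * b n\<close> reduces it to increments that are small compared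
  to those of \<open>b\<close>; these telescope, and the initial value is negligible because \<open>b\<close> is unbounded.
\<close>

lemma stolz_cesaro:
  fixes u b :: "nat \<Rightarrow> real"
  assumes b: "strict_mono b" "filterlim b at_top sequentially"
    and lim: "(\<lambda>n. (u (Suc n) - u n) / (b (Suc n) - b n)) \<longlonglongrightarrow> L"
  shows "(\<lambda>n. u n / b n) \<longlonglongrightarrow> L"
proof -
  define w where "w n = u n - L * b n" for n
  have db: "b (Suc n) - b n > 0" for n using b(1) by (simp add: strict_mono_Suc_iff)
  have "(\<lambda>n. w n / b n) \<longlonglongrightarrow> 0"
  proof (rule LIMSEQ_I)
    fix e :: real assume e: "0 < e"
    obtain N where N: "\<And>n. n \<ge> N \<Longrightarrow> \<bar>(u (Suc n) - u n) / (b (Suc n) - b n) - L\<bar> < e / 2"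
      using LIMSEQ_D[OF lim, of "e/2"] e by auto
    have increment: "\<bar>w (Suc n) - w n\<bar> \<le> e / 2 * (b (Suc n) - b n)" if "n \<ge> N" for n
    proof -
      have "w (Suc n) - w n
          = ((u (Suc n) - u n) / (b (Suc n) - b n) - L) * (b (Suc n) - b n)"
        using db[of n] by (simp add: w_def field_simps)
      then show ?thesis
        using N[OF that] db[of n] by (simp add: abs_mult mult_right_mono)
    qed
    have bound: "\<bar>w n\<bar> \<le> \<bar>w N\<bar> + e / 2 * (b n - b N)" if "n \<ge> N" for n
      using that
    proof (induction n rule: dec_induct)
      case (step n)
      have "\<bar>w (Suc n)\<bar> \<le> \<bar>w n\<bar> + \<bar>w (Suc n) - w n\<bar>" by linarith
      then show ?case using step(3) increment[OF step(1)]
        by (simp add: field_simps)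
    qed simp
    let ?C = "\<bar>w N\<bar> - e / 2 * b N"
    have "eventually (\<lambda>n. b n > max 1 (2 * ?C / e)) sequentially"
      using b(2) unfolding filterlim_at_top_dense by blast
    then have "eventually (\<lambda>n. norm (w n / b n - 0) < e) sequentially"
      using eventually_ge_at_top[of N]
    proof eventually_elim
      case (elim n)
      then have "2 * ?C / e < b n" "b n > 0" by auto
      then have "?C < e / 2 * b n" using e by (simp add: field_simps)
      with bound[of n] elim have "\<bar>w n\<bar> < e * b n" by (simp add: field_simps)
      then show ?case using \<open>b n > 0\<close> by (simp add: field_simps)
    qed
    then show "\<exists>no. \<forall>n\<ge>no. norm (w n / b n - 0) < e"
      by (simp add: eventually_sequentially)
  qed
  then have "(\<lambda>n. w n / b n + L) \<longlonglongrightarrow> L" using tendsto_add[OF _ tendsto_const] by fastforce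
  moreover have "eventually (\<lambda>n. w n / b n + L = u n / b n) sequentially"
    using b(2)[unfolded filterlim_at_top_dense, rule_format, of 0]
    by (rule eventually_mono) (simp add: w_def field_simps)
  ultimately show ?thesis by (rule Lim_transform_eventually)
qed

text \<open>
  The quotient is the difference quotient of \<open>x ^ Suc k\<close> at \<open>1\<close> with step \<open>1 / t\<close>.
\<close>

lemma power_increment_asymp:
  "(\<lambda>t. (real (Suc t) ^ Suc k - real t ^ Suc k) / real t ^ k) \<longlonglongrightarrow> real (Suc k)"
proof -
  have "((\<lambda>h. ((1 + h) ^ Suc k - 1 ^ Suc k) / h) \<longlongrightarrow> real (Suc k) * 1 ^ k) (at (0::real))"
    using DERIV_pow[of "Suc k" "1::real" UNIV] by (simp only: DERIV_def diff_Suc_Suc minus_nat.diff_0)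
  moreover have "filterlim (\<lambda>t. 1 / real t) (at 0) sequentially"
    by (auto intro!: filterlim_atI lim_const_over_n eventually_sequentiallyI[of 1])
  ultimately have "(\<lambda>t. ((1 + 1 / real t) ^ Suc k - 1 ^ Suc k) / (1 / real t)) \<longlonglongrightarrow> real (Suc k) * 1 ^ k"
    by (rule filterlim_compose)
  moreover have "eventually (\<lambda>t. ((1 + 1 / real t) ^ Suc k - 1 ^ Suc k) / (1 / real t)
      = (real (Suc t) ^ Suc k - real t ^ Suc k) / real t ^ k) sequentially"
  proof (rule eventually_sequentiallyI[of 1])
    fix t :: nat assume "1 \<le> t"
    then have "1 + 1 / real t = real (Suc t) / real t" "real t > 0" by (auto simp: field_simps)
    moreover have "((r / s) ^ Suc k - 1 ^ Suc k) / (1 / s) = (r ^ Suc k - s ^ Suc k) / s ^ k"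
      if "s > 0" for r s :: real
      using that by (simp add: power_divide field_simps)
    ultimately show "((1 + 1 / real t) ^ Suc k - 1 ^ Suc k) / (1 / real t)
      = (real (Suc t) ^ Suc k - real t ^ Suc k) / real t ^ k"
      by simp
  qed
  ultimately have "(\<lambda>t. (real (Suc t) ^ Suc k - real t ^ Suc k) / real t ^ k) \<longlonglongrightarrow> real (Suc k) * 1 ^ k"
    by (rule Lim_transform_eventually)
  then show ?thesis by (simp only: power_one mult_1_right)
qed

lemma power_growth_of_increments:
  fixes u :: "nat \<Rightarrow> real"
  assumes "(\<lambda>t. (u (Suc t) - u t) / real t ^ k) \<longlonglongrightarrow> a"
  shows "(\<lambda>t. u t / real t ^ Suc k) \<longlonglongrightarrow> a / real (Suc k)"
proof (rule stolz_cesaro)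
  show "strict_mono (\<lambda>t. real t ^ Suc k)"
    by (auto simp: strict_mono_def intro!: power_strict_mono simp del: power_Suc)
  show "filterlim (\<lambda>t. real t ^ Suc k) at_top sequentially"
    by (rule filterlim_pow_at_top) (auto simp: filterlim_real_sequentially)
  have "(\<lambda>t. (u (Suc t) - u t) / real t ^ k / ((real (Suc t) ^ Suc k - real t ^ Suc k) / real t ^ k))
      \<longlonglongrightarrow> a / real (Suc k)"
    by (intro tendsto_divide assms power_increment_asymp) simp
  moreover have "eventually (\<lambda>t. (u (Suc t) - u t) / real t ^ k / ((real (Suc t) ^ Suc k - real t ^ Suc k) / real t ^ k)
    = (u (Suc t) - u t) / (real (Suc t) ^ Suc k - real t ^ Suc k)) sequentially"
    by (rule eventually_sequentiallyI[of 1]) auto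
  ultimately show "(\<lambda>t. (u (Suc t) - u t) / (real (Suc t) ^ Suc k - real t ^ Suc k)) \<longlonglongrightarrow> a / real (Suc k)"
    by (rule Lim_transform_eventually)
qed

section \<open>Second differences of powers\<close>

text \<open>
  In the binomial expansion the first-order terms cancel, so what remains after the leading and the
  second-order term consists of terms in \<open>x ^ (n + 2 - i)\<close> with \<open>i \<ge> 3\<close>. The quotient
  \<open>R ^ (n + 2) / R ^ 3\<close> is written without truncated subtraction so that the bound is uniform
  in \<open>n\<close>, including \<open>n = 0\<close>, where the remainder vanishes.
\<close>

lemma second_difference_power:
  fixes x R :: real
  assumes x: "\<bar>x\<bar> \<le> R" and R: "1 \<le> R"
  shows "\<bar>((x + 1) ^ (n+2) + (x - 1) ^ (n+2)) / 2 - x ^ (n+2) - real ((n+2) choose 2) * x ^ n\<bar>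
    \<le> 2 ^ (n+2) * (R ^ (n+2) / R ^ 3)"
proof -
  let ?N = "n + 2"
  define c where "c i = real (?N choose i) * ((1 + (-1) ^ i) / 2) * x ^ (?N - i)" for i
  have "(x + 1) ^ ?N = (\<Sum>i\<le>?N. real (?N choose i) * x ^ (?N - i))"
    using binomial_ring[of 1 x ?N] by (simp add: add.commute)
  moreover have "(x - 1) ^ ?N = (\<Sum>i\<le>?N. real (?N choose i) * (-1) ^ i * x ^ (?N - i))"
    using binomial_ring[of "-1" x ?N] by simp
  ultimately have "((x + 1) ^ ?N + (x - 1) ^ ?N) / 2 = (\<Sum>i\<le>?N. c i)"
    unfolding c_def by (simp only: sum.distrib[symmetric] sum_divide_distrib)
      (intro sum.cong, auto simp: field_simps)
  also have "{..?N} = {0,1,2} \<union> {3..?N}" by auto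
  also have "sum c \<dots> = sum c {0,1,2} + sum c {3..?N}" by (rule sum.union_disjoint) auto
  also have "sum c {0,1,2} = x ^ ?N + real (?N choose 2) * x ^ n" by (simp add: c_def)
  finally have "\<bar>((x + 1) ^ ?N + (x - 1) ^ ?N) / 2 - x ^ ?N - real (?N choose 2) * x ^ n\<bar>
      = \<bar>sum c {3..?N}\<bar>" by (simp only: add_diff_cancel_left' diff_diff_eq)
  also have "\<dots> \<le> (\<Sum>i=3..?N. \<bar>c i\<bar>)" by (rule sum_abs)
  also have "\<dots> \<le> (\<Sum>i=3..?N. real (?N choose i) * (R ^ ?N / R ^ 3))"
  proof (rule sum_mono)
    fix i assume i: "i \<in> {3..?N}"
    have "\<bar>x\<bar> ^ (?N - i) \<le> R ^ (?N - i)" by (rule power_mono) (use x in auto)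
    also have "\<dots> = R ^ ?N / R ^ i" using i R by (simp add: power_diff)
    also have "\<dots> \<le> R ^ ?N / R ^ 3"
      using i R by (intro divide_left_mono power_increasing) auto
    finally have "\<bar>x\<bar> ^ (?N - i) \<le> R ^ ?N / R ^ 3" .
    moreover have "\<bar>(1 + (-1) ^ i) / 2 :: real\<bar> \<le> 1" by (cases "even i") auto
    ultimately have "\<bar>(1 + (-1) ^ i) / 2\<bar> * \<bar>x\<bar> ^ (?N - i) \<le> 1 * (R ^ ?N / R ^ 3)"
      by (intro mult_mono) auto
    then show "\<bar>c i\<bar> \<le> real (?N choose i) * (R ^ ?N / R ^ 3)"
      unfolding c_def abs_mult power_abs mult.assoc by (intro mult_mono) auto
  qed
  also have "\<dots> \<le> (\<Sum>i\<le>?N. real (?N choose i) * (R ^ ?N / R ^ 3))"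
    using R by (intro sum_mono2) auto
  also have "\<dots> = 2 ^ ?N * (R ^ ?N / R ^ 3)"
  proof -
    have "(\<Sum>i\<le>?N. real (?N choose i)) = 2 ^ ?N"
      by (metis choose_row_sum of_nat_sum of_nat_power of_nat_numeral)
    then show ?thesis by (simp only: sum_distrib_right[symmetric])
  qed
  finally show ?thesis .
qed

section \<open>One step of the dynamics\<close>

context
  fixes n :: int and m :: "int \<Rightarrow> real" and \<alpha> :: real
  assumes m: "sym_dist n m" and \<alpha>: "0 < \<alpha>" "\<alpha> < 1"
begin

lemma free_nonneg: "0 \<le> free \<alpha> m x"
  using frozen_le[OF m \<alpha>, of x] by (simp add: free_def)

lemma free_eq_0: "\<bar>x\<bar> > boundary \<alpha> m \<Longrightarrow> free \<alpha> m x = 0"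
  using m boundary_nonneg[OF m \<alpha>] by (auto simp: free_def frozen_def Let_def sym_dist_def abs_if)

lemma frozen_eq_0: "\<bar>x\<bar> < boundary \<alpha> m \<Longrightarrow> frozen \<alpha> m x = 0"
  by (auto simp: frozen_def Let_def)

text \<open>
  The discrete evolution equation in weak form: a step changes the mass distribution by half the
  discrete Laplacian of the free mass, and summation by parts moves the Laplacian to \<open>g\<close>.
\<close>

lemma sum_fbd_step:
  fixes g :: "int \<Rightarrow> real"
  shows "(\<Sum>x=-(n+1)..n+1. fbd_step \<alpha> m x * g x) = (\<Sum>x=-n..n. m x * g x)
    + (\<Sum>x=-n..n. free \<alpha> m x * ((g (x + 1) + g (x - 1)) / 2 - g x))"
proof -
  have b: "boundary \<alpha> m \<le> n" by (rule boundary_le[OF m \<alpha>])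
  have z: "free \<alpha> m x = 0" "frozen \<alpha> m x = 0" if "\<bar>x\<bar> > n" for x
  proof -
    show *: "free \<alpha> m x = 0" using that b by (intro free_eq_0) auto
    show "frozen \<alpha> m x = 0" using * m that by (auto simp: free_def sym_dist_def)
  qed
  have shift1: "(\<Sum>x=-(n+1)..n+1. free \<alpha> m (x - 1) * g x) = (\<Sum>x=-n..n. free \<alpha> m x * g (x + 1))"
  proof -
    have "(\<Sum>x=-(n+1)..n+1. free \<alpha> m (x - 1) * g x) = (\<Sum>x=-n-2..n. free \<alpha> m x * g (x + 1))"
      by (rule sum.reindex_bij_witness[of _ "\<lambda>x. x + 1" "\<lambda>x. x - 1"]) auto
    also have "\<dots> = (\<Sum>x=-n..n. free \<alpha> m x * g (x + 1))"
      by (rule sum.mono_neutral_right) (auto intro!: z)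
    finally show ?thesis .
  qed
  have shift2: "(\<Sum>x=-(n+1)..n+1. free \<alpha> m (x + 1) * g x) = (\<Sum>x=-n..n. free \<alpha> m x * g (x - 1))"
  proof -
    have "(\<Sum>x=-(n+1)..n+1. free \<alpha> m (x + 1) * g x) = (\<Sum>x=-n..n+2. free \<alpha> m x * g (x - 1))"
      by (rule sum.reindex_bij_witness[of _ "\<lambda>x. x - 1" "\<lambda>x. x + 1"]) auto
    also have "\<dots> = (\<Sum>x=-n..n. free \<alpha> m x * g (x - 1))"
      by (rule sum.mono_neutral_right) (auto intro!: z)
    finally show ?thesis .
  qed
  have shift0: "(\<Sum>x=-(n+1)..n+1. frozen \<alpha> m x * g x) = (\<Sum>x=-n..n. frozen \<alpha> m x * g x)"
    by (rule sum.mono_neutral_right) (auto intro!: z)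
  have "(\<Sum>x=-(n+1)..n+1. fbd_step \<alpha> m x * g x)
      = ((\<Sum>x=-(n+1)..n+1. free \<alpha> m (x - 1) * g x) + (\<Sum>x=-(n+1)..n+1. free \<alpha> m (x + 1) * g x)) / 2
        + (\<Sum>x=-(n+1)..n+1. frozen \<alpha> m x * g x)"
    unfolding sum.distrib[symmetric] sum_divide_distrib
    by (rule sum.cong) (auto simp: fbd_step_def field_simps)
  also have "\<dots> = (\<Sum>x=-n..n. m x * g x)
    + (\<Sum>x=-n..n. free \<alpha> m x * ((g (x + 1) + g (x - 1)) / 2 - g x))"
    unfolding shift0 shift1 shift2 sum.distrib[symmetric] sum_divide_distrib
    by (rule sum.cong) (auto simp: free_def field_simps)
  finally show ?thesis .
qed

text \<open>
  The support condition below is invariant under the dynamics (\<open>fbd_step_support\<close>). It confines the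
  frozen mass to the sites at distance \<open>\<beta>\<close> or \<open>\<beta> + 1\<close> from \<open>0\<close>, where \<open>\<beta>\<close> is the boundary.
\<close>

context
  assumes supp: "\<And>x. \<bar>x\<bar> > boundary \<alpha> m + 1 \<Longrightarrow> m x = 0"
begin

lemma infsum_beyond_boundary: "infsum m {boundary \<alpha> m<..} = m (boundary \<alpha> m + 1)"
proof -
  have "infsum m {boundary \<alpha> m<..} = sum m {boundary \<alpha> m + 1}"
    by (rule infsum_eq_sum) (use supp boundary_nonneg[OF m \<alpha>] in auto)
  then show ?thesis by simp
qed

text \<open>
  Frozen mass does not move, so the mass \<open>\<alpha> / 2\<close> frozen at or beyond the boundary is still there one step
  later.
\<close>

lemma boundary_le_boundary_fbd_step: "boundary \<alpha> m \<le> boundary \<alpha> (fbd_step \<alpha> m)"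
proof (cases "boundary \<alpha> m = 0")
  case True
  with boundary_nonneg[OF sym_dist_fbd_step[OF m \<alpha>] \<alpha>] show ?thesis by simp
next
  case False
  let ?b = "boundary \<alpha> m" and ?m = "fbd_step \<alpha> m"
  note m' = sym_dist_fbd_step[OF m \<alpha>]
  have b: "?b > 0" using False boundary_nonneg[OF m \<alpha>] by simp
  have le: "frozen \<alpha> m x \<le> ?m x" for x by (simp add: fbd_step_def free_nonneg)
  have "\<alpha> / 2 = frozen \<alpha> m ?b + frozen \<alpha> m (?b + 1)"
    using b by (simp add: frozen_def infsum_beyond_boundary)
  also have "\<dots> \<le> ?m ?b + ?m (?b + 1)" by (intro add_mono le)
  also have "\<dots> \<le> ?m ?b + (?m (?b + 1) + tail_mass ?m (?b + 1 + 1))"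
  proof -
    have "0 \<le> tail_mass ?m (?b + 1 + 1)"
      unfolding tail_mass_def using m' by (intro infsum_nonneg) (auto simp: sym_dist_def)
    then show ?thesis by simp
  qed
  also have "\<dots> = tail_mass ?m ?b" by (simp only: tail_mass_rec[OF m' \<alpha>, symmetric])
  finally have "\<not> boundary \<alpha> ?m < ?b" using tail_mass_gt_boundary[OF m' \<alpha>, of ?b] by auto
  then show ?thesis by simp
qed

lemma fbd_step_support: "\<bar>x\<bar> > boundary \<alpha> (fbd_step \<alpha> m) + 1 \<Longrightarrow> fbd_step \<alpha> m x = 0"
proof -
  assume "\<bar>x\<bar> > boundary \<alpha> (fbd_step \<alpha> m) + 1"
  then have x: "\<bar>x\<bar> > boundary \<alpha> m + 1" using boundary_le_boundary_fbd_step by simp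
  then have "free \<alpha> m (x - 1) = 0" "free \<alpha> m (x + 1) = 0" "free \<alpha> m x = 0"
    by (auto intro!: free_eq_0)
  then show ?thesis using supp[OF x] by (simp add: fbd_step_def free_def)
qed

text \<open>
  The frozen mass behaves like mass \<open>\<alpha>\<close> located at the boundary, up to one site.
\<close>

lemma sum_frozen_between:
  fixes g :: "int \<Rightarrow> real"
  assumes lo: "\<And>x. \<bar>x\<bar> \<in> {boundary \<alpha> m, boundary \<alpha> m + 1} \<Longrightarrow> l \<le> g x"
    and hi: "\<And>x. \<bar>x\<bar> \<in> {boundary \<alpha> m, boundary \<alpha> m + 1} \<Longrightarrow> g x \<le> h"
  shows "\<alpha> * l \<le> (\<Sum>x=-n..n. frozen \<alpha> m x * g x)" "(\<Sum>x=-n..n. frozen \<alpha> m x * g x) \<le> \<alpha> * h"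
proof -
  let ?b = "boundary \<alpha> m"
  let ?B = "{?b, ?b + 1, - ?b, - ?b - 1}"
  have b: "0 \<le> ?b" by (rule boundary_nonneg[OF m \<alpha>])
  have mm: "m (-x) = m x" for x using m by (simp add: sym_dist_def)
  have z: "frozen \<alpha> m x = 0" if "x \<notin> ?B \<or> \<bar>x\<bar> > n" for x
  proof (cases "\<bar>x\<bar> < ?b")
    case True then show ?thesis by (rule frozen_eq_0)
  next
    case False
    with that have "\<bar>x\<bar> > ?b + 1 \<or> \<bar>x\<bar> > n" by auto
    then have "m x = 0" using supp m by (auto simp: sym_dist_def)
    then show ?thesis using frozen_le[OF m \<alpha>, of x] frozen_nonneg[OF m \<alpha>, of x] by simp
  qed
  have eq: "(\<Sum>x=-n..n. frozen \<alpha> m x * h x) = (\<Sum>x\<in>?B. frozen \<alpha> m x * h x)" for h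
  proof (rule sum.mono_neutral_cong)
    show "frozen \<alpha> m x * h x = 0" if "x \<in> {-n..n} - ?B" for x
      using z[of x] that by (simp only: Diff_iff) simp
    show "frozen \<alpha> m x * h x = 0" if "x \<in> ?B - {-n..n}" for x
    proof -
      have "\<bar>x\<bar> > n" using that by (simp only: Diff_iff atLeastAtMost_iff) linarith
      then show ?thesis using z[of x] by simp
    qed
  qed auto
  have total: "(\<Sum>x\<in>?B. frozen \<alpha> m x) = \<alpha>"
  proof (cases "?b = 0")
    case True
    then have B: "?B = {0, 1, -1}" by auto
    show ?thesis unfolding B
      using True infsum_beyond_boundary mm[of 1] by (simp add: frozen_def)
  next
    case False
    with b have "?b > 0" by simp
    then show ?thesis
      by (simp add: frozen_def infsum_beyond_boundary add.commute)
  qed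
  have f: "0 \<le> frozen \<alpha> m x" for x by (rule frozen_nonneg[OF m \<alpha>])
  have inB: "\<bar>x\<bar> \<in> {?b, ?b + 1}" if "x \<in> ?B" for x using that b by auto
  have "\<alpha> * l = (\<Sum>x\<in>?B. frozen \<alpha> m x * l)" using total by (simp only: sum_distrib_right[symmetric])
  also have "\<dots> \<le> (\<Sum>x\<in>?B. frozen \<alpha> m x * g x)"
    by (intro sum_mono mult_left_mono lo inB f)
  finally show "\<alpha> * l \<le> (\<Sum>x=-n..n. frozen \<alpha> m x * g x)" by (simp only: eq)
  have "(\<Sum>x\<in>?B. frozen \<alpha> m x * g x) \<le> (\<Sum>x\<in>?B. frozen \<alpha> m x * h)"
    by (intro sum_mono mult_left_mono hi inB f)
  also have "\<dots> = \<alpha> * h" using total by (simp only: sum_distrib_right[symmetric])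
  finally show "(\<Sum>x=-n..n. frozen \<alpha> m x * g x) \<le> \<alpha> * h" by (simp only: eq)
qed

end

end

section \<open>Convergence of the rescaled moments\<close>

lemma fbd_support:
  assumes "0 < \<alpha>" "\<alpha> < 1" "\<bar>x\<bar> > fbd_boundary \<alpha> t + 1"
  shows "fbd \<alpha> t x = 0"
  using assms(3)
proof (induction t arbitrary: x)
  case 0
  then show ?case
    using boundary_nonneg[OF sym_dist_fbd[OF assms(1,2), of 0] assms(1,2)]
    by (auto simp: fbd_boundary_def)
next
  case (Suc t)
  show ?case
    using fbd_step_support[OF sym_dist_fbd[OF assms(1,2), of t] assms(1,2)] Suc
    by (auto simp: fbd_boundary_def)
qed

definition fbd_moment :: "real \<Rightarrow> nat \<Rightarrow> nat \<Rightarrow> real" where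
  "fbd_moment \<alpha> n t = (\<Sum>x=-int t..int t. fbd \<alpha> t x * real_of_int x ^ n)"

text \<open>
  The limits of the even rescaled moments. The subtracted term is the contribution of the frozen mass,
  which does not diffuse.
\<close>

primrec limit_moment :: "real \<Rightarrow> real \<Rightarrow> nat \<Rightarrow> real" where
  "limit_moment \<alpha> c 0 = 1"
| "limit_moment \<alpha> c (Suc k) = (2 * real k + 1) * (limit_moment \<alpha> c k - \<alpha> * c ^ (2 * k))"

lemma fbd_moment_odd:
  assumes "0 < \<alpha>" "\<alpha> < 1" "odd n"
  shows "fbd_moment \<alpha> n t = 0"
proof -
  have "fbd \<alpha> t (- x) = fbd \<alpha> t x" for x
    using sym_dist_fbd[OF assms(1,2), of t] by (simp add: sym_dist_def)
  then have "fbd_moment \<alpha> n t = (\<Sum>x=-int t..int t. - (fbd \<alpha> t x * real_of_int x ^ n))"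
    unfolding fbd_moment_def using assms(3)
    by (intro sum.reindex_bij_witness[of _ uminus uminus]) auto
  then show ?thesis by (simp add: sum_negf fbd_moment_def)
qed

lemma sqrt_power_even: "sqrt (real t) ^ (2 * k) = real t ^ k"
  by (simp add: power_mult)

context
  fixes \<alpha> :: real
  assumes \<alpha>: "0 < \<alpha>" "\<alpha> < 1"
begin

private abbreviation (input) "\<beta> t \<equiv> real_of_int (fbd_boundary \<alpha> t)"

private lemma fbd_boundary_nonneg: "0 \<le> fbd_boundary \<alpha> t"
  unfolding fbd_boundary_def by (rule boundary_nonneg[OF sym_dist_fbd[OF \<alpha>] \<alpha>])

private lemma supp: "\<bar>x\<bar> > boundary \<alpha> (fbd \<alpha> t) + 1 \<Longrightarrow> fbd \<alpha> t x = 0"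
  using fbd_support[OF \<alpha>] by (simp add: fbd_boundary_def)

lemma abs_le_front:
  assumes "fbd \<alpha> t x \<noteq> 0"
  shows "\<bar>real_of_int x\<bar> \<le> \<beta> t + 1"
proof -
  have "\<bar>x\<bar> \<le> fbd_boundary \<alpha> t + 1" using fbd_support[OF \<alpha>, of t x] assms by linarith
  then have "real_of_int \<bar>x\<bar> \<le> real_of_int (fbd_boundary \<alpha> t + 1)" by (rule of_int_le_iff[THEN iffD2])
  then show ?thesis by simp
qed

text \<open>
  The weak evolution equation for powers. The free mass is dominated by \<open>\<mu>\<^sub>t\<close>, a probability
  distribution, so the error of the second difference passes to the moment increment unchanged.
\<close>

lemma fbd_moment_increment:
  assumes R: "1 \<le> R" "\<beta> t + 1 \<le> R"
  shows "\<bar>fbd_moment \<alpha> (n + 2) (Suc t) - fbd_moment \<alpha> (n + 2) t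
      - real ((n+2) choose 2) * (\<Sum>x=-int t..int t. free \<alpha> (fbd \<alpha> t) x * real_of_int x ^ n)\<bar>
    \<le> 2 ^ (n+2) * (R ^ (n+2) / R ^ 3)"
proof -
  let ?m = "fbd \<alpha> t" and ?I = "{-int t..int t}"
  let ?C = "2 ^ (n+2) * (R ^ (n+2) / R ^ 3)"
  note sym = sym_dist_fbd[OF \<alpha>, of t]
  define d where "d x = ((real_of_int x + 1) ^ (n+2) + (real_of_int x - 1) ^ (n+2)) / 2 - real_of_int x ^ (n+2)" for x
  have fr: "0 \<le> free \<alpha> ?m x" "free \<alpha> ?m x \<le> ?m x" for x
    using free_nonneg[OF sym \<alpha>] frozen_nonneg[OF sym \<alpha>, of x] by (auto simp: free_def)
  have "fbd_moment \<alpha> (n + 2) (Suc t) = fbd_moment \<alpha> (n + 2) t + (\<Sum>x\<in>?I. free \<alpha> ?m x * d x)"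
    using sum_fbd_step[OF sym \<alpha>, of "\<lambda>x. real_of_int x ^ (n+2)"]
    by (simp add: fbd_moment_def d_def add.commute)
  then have "\<bar>fbd_moment \<alpha> (n + 2) (Suc t) - fbd_moment \<alpha> (n + 2) t
      - real ((n+2) choose 2) * (\<Sum>x\<in>?I. free \<alpha> ?m x * real_of_int x ^ n)\<bar>
    = \<bar>\<Sum>x\<in>?I. free \<alpha> ?m x * (d x - real ((n+2) choose 2) * real_of_int x ^ n)\<bar>"
    by (simp add: sum_subtractf[symmetric] sum_distrib_left right_diff_distrib mult.left_commute)
  also have "\<dots> \<le> (\<Sum>x\<in>?I. \<bar>free \<alpha> ?m x * (d x - real ((n+2) choose 2) * real_of_int x ^ n)\<bar>)"
    by (rule sum_abs)
  also have "\<dots> \<le> (\<Sum>x\<in>?I. ?m x * ?C)"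
  proof (rule sum_mono)
    fix x
    show "\<bar>free \<alpha> ?m x * (d x - real ((n+2) choose 2) * real_of_int x ^ n)\<bar> \<le> ?m x * ?C"
    proof (cases "?m x = 0")
      case True
      with fr[of x] have "free \<alpha> ?m x = 0" by simp
      with True show ?thesis by simp
    next
      case False
      then have "\<bar>real_of_int x\<bar> \<le> R" using abs_le_front[of t x] R by simp
      then have "\<bar>d x - real ((n+2) choose 2) * real_of_int x ^ n\<bar> \<le> ?C"
        unfolding d_def using R(1) by (rule second_difference_power)
      then show ?thesis
        unfolding abs_mult using fr[of x] R(1) by (intro mult_mono) auto
    qed
  qed
  also have "\<dots> = ?C"
    using sym by (simp only: sum_distrib_right[symmetric] sym_dist_def mult_1_left)
  finally show ?thesis .
qed

context
  fixes c :: real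
  assumes lim: "(\<lambda>t. real_of_int (fbd_boundary \<alpha> t) / sqrt (real t)) \<longlonglongrightarrow> c"
begin

lemma boundary_limit_nonneg: "0 \<le> c"
  by (rule tendsto_lowerbound[OF lim]) (auto simp: fbd_boundary_nonneg)

lemma front_limit: "(\<lambda>t. (\<beta> t + 1) / sqrt (real t)) \<longlonglongrightarrow> c"
proof -
  have "(\<lambda>t. 1 / sqrt (real t)) \<longlonglongrightarrow> 0" by real_asymp
  from tendsto_add[OF lim this] show ?thesis by (simp add: add_divide_distrib)
qed

lemma frozen_moment_limit:
  "(\<lambda>t. (\<Sum>x=-int t..int t. frozen \<alpha> (fbd \<alpha> t) x * real_of_int x ^ (2 * k)) / real t ^ k)
    \<longlonglongrightarrow> \<alpha> * c ^ (2 * k)" (is "(\<lambda>t. ?F t / _) \<longlonglongrightarrow> _")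
proof (rule tendsto_sandwich)
  have "\<alpha> * \<beta> t ^ (2 * k) \<le> ?F t \<and> ?F t \<le> \<alpha> * (\<beta> t + 1) ^ (2 * k)" for t
  proof -
    have "\<beta> t ^ (2 * k) \<le> real_of_int x ^ (2 * k) \<and> real_of_int x ^ (2 * k) \<le> (\<beta> t + 1) ^ (2 * k)"
      if "\<bar>x\<bar> \<in> {fbd_boundary \<alpha> t, fbd_boundary \<alpha> t + 1}" for x
    proof -
      have "\<beta> t \<le> real_of_int \<bar>x\<bar>" "real_of_int \<bar>x\<bar> \<le> \<beta> t + 1" using that by auto
      then have "\<beta> t ^ (2 * k) \<le> real_of_int \<bar>x\<bar> ^ (2 * k)"
        "real_of_int \<bar>x\<bar> ^ (2 * k) \<le> (\<beta> t + 1) ^ (2 * k)"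
        using fbd_boundary_nonneg[of t] by (auto intro!: power_mono)
      then show ?thesis by (simp add: power_even_abs)
    qed
    then show ?thesis
      using sum_frozen_between[OF sym_dist_fbd[OF \<alpha>, of t] \<alpha> supp,
          of "\<beta> t ^ (2 * k)" "\<lambda>x. real_of_int x ^ (2 * k)" "(\<beta> t + 1) ^ (2 * k)"]
      unfolding fbd_boundary_def by blast
  qed
  then have "\<alpha> * \<beta> t ^ (2 * k) / real t ^ k \<le> ?F t / real t ^ k"
    "?F t / real t ^ k \<le> \<alpha> * (\<beta> t + 1) ^ (2 * k) / real t ^ k" for t
    by (simp_all add: divide_right_mono)
  then show "\<forall>\<^sub>F t in sequentially. \<alpha> * (\<beta> t / sqrt (real t)) ^ (2 * k) \<le> ?F t / real t ^ k"
    "\<forall>\<^sub>F t in sequentially. ?F t / real t ^ k \<le> \<alpha> * ((\<beta> t + 1) / sqrt (real t)) ^ (2 * k)"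
    by (auto simp: power_divide sqrt_power_even)
  show "(\<lambda>t. \<alpha> * (\<beta> t / sqrt (real t)) ^ (2 * k)) \<longlonglongrightarrow> \<alpha> * c ^ (2 * k)"
    "(\<lambda>t. \<alpha> * ((\<beta> t + 1) / sqrt (real t)) ^ (2 * k)) \<longlonglongrightarrow> \<alpha> * c ^ (2 * k)"
    by (intro tendsto_intros lim front_limit)+
qed

text \<open>
  Divided by \<open>t ^ k\<close>, the increments of the moment of order \<open>2 * k + 2\<close> converge, since the free mass
  is all mass minus the frozen mass. Summation over time turns this into growth of order
  \<open>t ^ (k + 1)\<close> and divides the binomial coefficient by \<open>k + 1\<close>.
\<close>

lemma fbd_moment_even_limit:
  "(\<lambda>t. fbd_moment \<alpha> (2 * k) t / real t ^ k) \<longlonglongrightarrow> limit_moment \<alpha> c k"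
proof (induction k)
  case 0
  show ?case using sym_dist_fbd[OF \<alpha>] by (simp add: fbd_moment_def sym_dist_def)
next
  case (Suc k)
  let ?n = "2 * k"
  let ?C = "real ((?n + 2) choose 2)"
  define D where "D t = (\<Sum>x=-int t..int t. free \<alpha> (fbd \<alpha> t) x * real_of_int x ^ ?n)" for t
  \<comment> \<open>Adding \<open>sqrt t\<close> makes this bound on the support tend to infinity even if \<open>c = 0\<close>, which is
    excluded only afterwards, by the case \<open>k = 1\<close> of this lemma.\<close>
  define R where "R t = \<beta> t + 1 + sqrt (real t)" for t
  define E where "E t = fbd_moment \<alpha> (?n + 2) (Suc t) - fbd_moment \<alpha> (?n + 2) t - ?C * D t" for t
  have "(\<lambda>t. fbd_moment \<alpha> ?n t / real t ^ k
      - (\<Sum>x=-int t..int t. frozen \<alpha> (fbd \<alpha> t) x * real_of_int x ^ ?n) / real t ^ k)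
    \<longlonglongrightarrow> limit_moment \<alpha> c k - \<alpha> * c ^ ?n"
    by (intro tendsto_diff Suc frozen_moment_limit)
  then have D: "(\<lambda>t. D t / real t ^ k) \<longlonglongrightarrow> limit_moment \<alpha> c k - \<alpha> * c ^ ?n"
    by (simp add: D_def fbd_moment_def free_def left_diff_distrib sum_subtractf diff_divide_distrib)
  have R1: "1 \<le> R t" "\<beta> t + 1 \<le> R t" for t
    using fbd_boundary_nonneg[of t] by (auto simp: R_def)
  have "filterlim R at_top sequentially"
  proof (rule filterlim_at_top_mono)
    show "filterlim (\<lambda>t. sqrt (real t)) at_top sequentially" by real_asymp
  qed (use fbd_boundary_nonneg in \<open>auto simp: R_def intro!: always_eventually add_nonneg_nonneg\<close>)
  then have "(\<lambda>t. inverse (R t)) \<longlonglongrightarrow> 0" by (rule tendsto_inverse_0_at_top)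
  moreover have "(\<lambda>t. R t / sqrt (real t)) \<longlonglongrightarrow> c + 1"
  proof (rule Lim_transform_eventually)
    show "(\<lambda>t. (\<beta> t + 1) / sqrt (real t) + 1) \<longlonglongrightarrow> c + 1"
      by (intro tendsto_intros front_limit)
  qed (auto simp: R_def field_simps intro!: eventually_sequentiallyI[of 1])
  ultimately have "(\<lambda>t. 2 ^ (?n+2) * ((R t / sqrt (real t)) ^ ?n * inverse (R t)))
      \<longlonglongrightarrow> 2 ^ (?n+2) * ((c + 1) ^ ?n * 0)"
    by (intro tendsto_intros)
  then have "(\<lambda>t. 2 ^ (?n+2) * ((R t / sqrt (real t)) ^ ?n * inverse (R t))) \<longlonglongrightarrow> 0" by simp
  then have "(\<lambda>t. E t / real t ^ k) \<longlonglongrightarrow> 0"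
  proof (rule Lim_null_comparison[rotated])
    have "norm (E t / real t ^ k) \<le> 2 ^ (?n+2) * ((R t / sqrt (real t)) ^ ?n * inverse (R t))" for t
    proof -
      have "\<bar>E t\<bar> \<le> 2 ^ (?n+2) * (R t ^ (?n+2) / R t ^ 3)"
        unfolding E_def D_def by (rule fbd_moment_increment[OF R1])
      also have "R t ^ (?n+2) / R t ^ 3 = R t ^ ?n * inverse (R t)"
        using R1(1)[of t] by (simp add: power_add field_simps power2_eq_square power3_eq_cube)
      finally have "\<bar>E t\<bar> / real t ^ k \<le> 2 ^ (?n+2) * (R t ^ ?n * inverse (R t)) / real t ^ k"
        by (rule divide_right_mono) simp
      then show ?thesis by (simp add: power_divide sqrt_power_even)
    qed
    then show "\<forall>\<^sub>F t in sequentially. norm (E t / real t ^ k)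
        \<le> 2 ^ (?n+2) * ((R t / sqrt (real t)) ^ ?n * inverse (R t))" by simp
  qed
  then have "(\<lambda>t. E t / real t ^ k + ?C * (D t / real t ^ k))
      \<longlonglongrightarrow> 0 + ?C * (limit_moment \<alpha> c k - \<alpha> * c ^ ?n)"
    by (intro tendsto_intros D)
  then have "(\<lambda>t. (fbd_moment \<alpha> (?n + 2) (Suc t) - fbd_moment \<alpha> (?n + 2) t) / real t ^ k)
      \<longlonglongrightarrow> ?C * (limit_moment \<alpha> c k - \<alpha> * c ^ ?n)"
    by (simp add: E_def diff_divide_distrib)
  then have "(\<lambda>t. fbd_moment \<alpha> (?n + 2) t / real t ^ Suc k)
      \<longlonglongrightarrow> ?C * (limit_moment \<alpha> c k - \<alpha> * c ^ ?n) / real (Suc k)"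
    by (rule power_growth_of_increments)
  moreover have "?C = real (Suc k) * (2 * real k + 1)"
  proof -
    have "(?n + 2) choose 2 = Suc k * (2 * k + 1)" by (simp add: choose_two)
    then show ?thesis by (simp only: of_nat_mult) simp
  qed
  ultimately show ?case by simp
qed

text \<open>
  These bounds express that the limit lives on \<open>[-c, c]\<close>; they are what excludes a defect in the
  equation for \<open>c\<close> later on.
\<close>

lemma limit_moment_bounds: "0 \<le> limit_moment \<alpha> c k" "limit_moment \<alpha> c k \<le> c ^ (2 * k)"
proof -
  have m: "0 \<le> fbd \<alpha> t x" for t x using sym_dist_fbd[OF \<alpha>] by (simp add: sym_dist_def)
  show "0 \<le> limit_moment \<alpha> c k"
    by (rule tendsto_lowerbound[OF fbd_moment_even_limit])
      (auto simp: fbd_moment_def m intro!: always_eventually divide_nonneg_nonneg sum_nonneg)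
  have "fbd_moment \<alpha> (2 * k) t \<le> (\<beta> t + 1) ^ (2 * k)" for t
  proof -
    have "fbd_moment \<alpha> (2 * k) t \<le> (\<Sum>x=-int t..int t. fbd \<alpha> t x * (\<beta> t + 1) ^ (2 * k))"
      unfolding fbd_moment_def
    proof (rule sum_mono)
      fix x
      have "real_of_int x ^ (2 * k) \<le> (\<beta> t + 1) ^ (2 * k)" if "fbd \<alpha> t x \<noteq> 0"
      proof -
        have "\<bar>real_of_int x\<bar> ^ (2 * k) \<le> (\<beta> t + 1) ^ (2 * k)"
          by (intro power_mono abs_le_front that) simp
        then show ?thesis by (simp add: power_even_abs)
      qed
      then show "fbd \<alpha> t x * real_of_int x ^ (2 * k) \<le> fbd \<alpha> t x * (\<beta> t + 1) ^ (2 * k)"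
        using m by (cases "fbd \<alpha> t x = 0") (auto intro!: mult_left_mono)
    qed
    also have "\<dots> = (\<beta> t + 1) ^ (2 * k)"
      using sym_dist_fbd[OF \<alpha>, of t] by (simp add: sum_distrib_right[symmetric] sym_dist_def)
    finally show ?thesis .
  qed
  then have "fbd_moment \<alpha> (2 * k) t / real t ^ k \<le> ((\<beta> t + 1) / sqrt (real t)) ^ (2 * k)" for t
    by (simp add: power_divide sqrt_power_even divide_right_mono)
  then show "limit_moment \<alpha> c k \<le> c ^ (2 * k)"
    by (intro LIMSEQ_le[OF fbd_moment_even_limit tendsto_power[OF front_limit]]) auto
qed

text \<open>
  The variance of \<open>\<mu>\<^sub>t\<close> is exactly \<open>(1 - \<alpha>) * t\<close>, which forces spreading on the scale \<open>sqrt t\<close>.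
\<close>

lemma boundary_limit_pos: "0 < c"
proof -
  have "1 - \<alpha> \<le> c\<^sup>2" using limit_moment_bounds(2)[of 1] by simp
  then have "c \<noteq> 0" using \<alpha> by auto
  then show ?thesis using boundary_limit_nonneg by simp
qed

end

end

section \<open>Integration against the limit measure\<close>

lemma continuous_on_std_normal_density [continuous_intros]:
  "continuous_on S std_normal_density"
  unfolding std_normal_density_def[abs_def] by (intro continuous_intros) auto

lemma integrable_times_std_normal_density:
  fixes f :: "real \<Rightarrow> real"
  assumes "continuous_on {a..b} f"
  shows "(\<lambda>x. f x * std_normal_density x) integrable_on {a..b}"
  by (intro integrable_continuous_interval continuous_intros assms)

text \<open>
  Integration by parts, using that the derivative of the Gaussian density is \<open>- x\<close> times the density.
\<close>

lemma std_normal_moment_rec: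
  assumes "0 \<le> c"
  shows "integral {-c..c} (\<lambda>x. x ^ (2 * Suc k) * std_normal_density x)
    = (2 * real k + 1) * integral {-c..c} (\<lambda>x. x ^ (2 * k) * std_normal_density x)
      - 2 * c ^ (2 * k + 1) * std_normal_density c"
proof -
  let ?\<phi> = std_normal_density
  let ?F = "\<lambda>x. x ^ (2 * k + 1) * ?\<phi> x"
  let ?f = "\<lambda>x. (2 * real k + 1) * (x ^ (2 * k) * ?\<phi> x) - x ^ (2 * Suc k) * ?\<phi> x"
  have "(?F has_vector_derivative ?f x) (at x within {-c..c})" for x
    unfolding has_real_derivative_iff_has_vector_derivative[symmetric] std_normal_density_def
    by (rule derivative_eq_intros refl | simp)+ (simp add: field_simps power2_eq_square)
  with assms have "(?f has_integral (?F c - ?F (-c))) {-c..c}"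
    by (intro fundamental_theorem_of_calculus) auto
  then have "integral {-c..c} ?f = ?F c - ?F (-c)" by (rule integral_unique)
  also have "\<dots> = 2 * c ^ (2 * k + 1) * ?\<phi> c" by (simp add: std_normal_density_def)
  also have "integral {-c..c} ?f
      = (2 * real k + 1) * integral {-c..c} (\<lambda>x. x ^ (2 * k) * ?\<phi> x)
        - integral {-c..c} (\<lambda>x. x ^ (2 * Suc k) * ?\<phi> x)"
  proof -
    have int: "(\<lambda>x. x ^ n * ?\<phi> x) integrable_on {-c..c}" for n
      by (intro integrable_times_std_normal_density continuous_intros)
    have "(\<lambda>x. (2 * real k + 1) * (x ^ (2 * k) * ?\<phi> x)) integrable_on {-c..c}"
      using integrable_cmul[OF int, of "2 * real k + 1" "2 * k"] by (simp only: real_scaleR_def)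
    from Henstock_Kurzweil_Integration.integral_diff[OF this int] show ?thesis
      by (simp only: Henstock_Kurzweil_Integration.integral_mult_right)
  qed
  finally show ?thesis by simp
qed

lemma std_normal_moment_odd:
  assumes "odd n"
  shows "integral {-c..c} (\<lambda>x. x ^ n * std_normal_density x) = 0"
proof -
  let ?f = "\<lambda>x::real. x ^ n * std_normal_density x"
  have "integral {-c..c} ?f = integral {-c..c} (\<lambda>x. ?f (- x))"
    using Henstock_Kurzweil_Integration.integral_reflect_real[of c "-c" ?f] by simp
  also have "(\<lambda>x. ?f (- x)) = (\<lambda>x. - ?f x)"
    using assms by (simp add: std_normal_density_def)
  finally show ?thesis by simp
qed

lemma measure_std_gaussian_interval:
  "measure std_gaussian {-c..c} = integral {-c..c} std_normal_density"
proof -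
  have "(std_normal_density has_integral integral {-c..c} std_normal_density) {-c..c}"
    by (intro integrable_integral integrable_continuous_interval continuous_intros)
  then have "(\<integral>\<^sup>+x. ennreal (std_normal_density x) * indicator {-c..c} x \<partial>lborel)
      = ennreal (integral {-c..c} std_normal_density)"
    by (intro nn_integral_has_integral_lebesgue') simp_all
  then show ?thesis
    by (simp add: measure_def std_gaussian_def emeasure_density Henstock_Kurzweil_Integration.integral_nonneg
        integrable_continuous_interval continuous_on_std_normal_density)
qed

text \<open>
  Integration against \<open>fbd_limit \<alpha> q\<close>, see \<open>integral_fbd_limit\<close>. The explicit form in terms of gauge
  integrals makes the fundamental theorem of calculus available for polynomials.
\<close>

definition limit_expectation :: "real \<Rightarrow> real \<Rightarrow> (real \<Rightarrow> real) \<Rightarrow> real" where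
  "limit_expectation \<alpha> q f = \<alpha> / 2 * f (- q)
     + (1 - \<alpha>) * (integral {-q..q} (\<lambda>x. f x * std_normal_density x) / measure std_gaussian {-q..q})
     + \<alpha> / 2 * f q"

lemma limit_expectation_const: "q > 0 \<Longrightarrow> limit_expectation \<alpha> q (\<lambda>_. a) = a"
proof -
  assume "q > 0"
  then have Z: "integral {-q..q} std_normal_density / measure std_gaussian {-q..q} = 1"
    using measure_std_gaussian_pos[of q] by (simp add: measure_std_gaussian_interval)
  have "limit_expectation \<alpha> q (\<lambda>_. a) = \<alpha> / 2 * a
      + (1 - \<alpha>) * (a * (integral {-q..q} std_normal_density / measure std_gaussian {-q..q})) + \<alpha> / 2 * a"
    by (simp only: limit_expectation_def Henstock_Kurzweil_Integration.integral_mult_right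
        times_divide_eq_right)
  then show ?thesis unfolding Z by (simp add: algebra_simps)
qed

lemma limit_expectation_odd: "odd n \<Longrightarrow> limit_expectation \<alpha> q (\<lambda>x. x ^ n) = 0"
  by (simp add: limit_expectation_def std_normal_moment_odd)

text \<open>
  The recursion of \<open>limit_moment\<close>, except for a last term that measures by how much \<open>q\<close> fails to
  satisfy the equation characterising the limit.
\<close>

lemma limit_expectation_even_rec:
  assumes "q > 0"
  shows "limit_expectation \<alpha> q (\<lambda>x. x ^ (2 * Suc k))
    = (2 * real k + 1) * (limit_expectation \<alpha> q (\<lambda>x. x ^ (2 * k)) - \<alpha> * q ^ (2 * k))
      + (\<alpha> - 2 * (1 - \<alpha>) * std_normal_density q / (q * measure std_gaussian {-q..q})) * q ^ (2 * Suc k)"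
proof -
  define P where "P = q ^ (2 * k)"
  define J where "J = integral {-q..q} (\<lambda>x. x ^ (2 * k) * std_normal_density x)"
  define Z where "Z = measure std_gaussian {-q..q}"
  define \<phi> where "\<phi> = std_normal_density q"
  have "Z > 0" unfolding Z_def by (rule measure_std_gaussian_pos[OF assms])
  have pow: "(- q) ^ (2 * k) = P" "q ^ (2 * Suc k) = P * q * q" "(- q) ^ (2 * Suc k) = P * q * q"
    by (simp_all add: P_def)
  have J: "integral {-q..q} (\<lambda>x. x ^ (2 * Suc k) * std_normal_density x)
      = (2 * real k + 1) * J - 2 * (P * q) * \<phi>"
    unfolding std_normal_moment_rec[OF less_imp_le[OF assms]] by (simp add: J_def P_def \<phi>_def)
  have "\<alpha> / 2 * (P * q * q) + (1 - \<alpha>) * (((2 * real k + 1) * J - 2 * (P * q) * \<phi>) / Z) + \<alpha> / 2 * (P * q * q)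
      = (2 * real k + 1) * (\<alpha> / 2 * P + (1 - \<alpha>) * (J / Z) + \<alpha> / 2 * P - \<alpha> * P)
        + (\<alpha> - 2 * (1 - \<alpha>) * \<phi> / (q * Z)) * (P * q * q)"
    using assms \<open>Z > 0\<close> by (simp add: field_simps)
  then show ?thesis
    unfolding limit_expectation_def J pow by (simp only: J_def P_def Z_def \<phi>_def)
qed

lemma limit_expectation_add:
  assumes "continuous_on {-q..q} f" "continuous_on {-q..q} g"
  shows "limit_expectation \<alpha> q (\<lambda>x. f x + g x) = limit_expectation \<alpha> q f + limit_expectation \<alpha> q g"
proof -
  have "integral {-q..q} (\<lambda>x. f x * std_normal_density x + g x * std_normal_density x)
    = integral {-q..q} (\<lambda>x. f x * std_normal_density x) + integral {-q..q} (\<lambda>x. g x * std_normal_density x)"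
    by (intro Henstock_Kurzweil_Integration.integral_add integrable_times_std_normal_density assms)
  then show ?thesis
    by (simp add: limit_expectation_def distrib_right distrib_left add_divide_distrib)
qed

lemma limit_expectation_cmult:
  "limit_expectation \<alpha> q (\<lambda>x. a * f x) = a * limit_expectation \<alpha> q f"
proof -
  have "integral {-q..q} (\<lambda>x. a * f x * std_normal_density x)
      = a * integral {-q..q} (\<lambda>x. f x * std_normal_density x)"
    by (simp only: mult.assoc Henstock_Kurzweil_Integration.integral_mult_right)
  then show ?thesis
    unfolding limit_expectation_def by (simp add: algebra_simps)
qed

lemma limit_expectation_add_const:
  assumes "q > 0" "continuous_on {-q..q} f"
  shows "limit_expectation \<alpha> q (\<lambda>x. f x + a) = limit_expectation \<alpha> q f + a"
  by (simp only: limit_expectation_add[OF assms(2) continuous_on_const] limit_expectation_const[OF assms(1)])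

lemma limit_expectation_mono:
  assumes "q > 0" "0 < \<alpha>" "\<alpha> < 1"
    and "continuous_on {-q..q} f" "continuous_on {-q..q} g" "\<And>x. x \<in> {-q..q} \<Longrightarrow> f x \<le> g x"
  shows "limit_expectation \<alpha> q f \<le> limit_expectation \<alpha> q g"
  unfolding limit_expectation_def using assms measure_std_gaussian_pos[of q]
  by (intro add_mono mult_left_mono divide_right_mono integral_le integrable_times_std_normal_density
      mult_right_mono) auto

text \<open>
  \<open>fbd_limit\<close> is given by its values on sets, so the formula for integrals is built up from indicator
  functions.
\<close>

lemma nn_integral_fbd_limit:
  assumes [measurable]: "f \<in> borel_measurable borel"
  shows "(\<integral>\<^sup>+x. f x \<partial>fbd_limit \<alpha> q)
    = ennreal (\<alpha> / 2) * f (- q) + ennreal (1 - \<alpha>) * (\<integral>\<^sup>+x. f x \<partial>trunc_gaussian q) + ennreal (\<alpha> / 2) * f q"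
  using assms
proof (induction f rule: borel_measurable_induct)
  case (cong f g)
  then show ?case by (simp add: fun_eq_iff[symmetric] cong: nn_integral_cong)
next
  case (set A)
  then show ?case by (simp add: emeasure_fbd_limit)
next
  case (mult u a)
  then show ?case by (simp add: nn_integral_cmult distrib_left mult.left_commute)
next
  case (add u v)
  then show ?case by (simp add: nn_integral_add distrib_left distrib_right ac_simps)
next
  case (seq U)
  have [measurable]: "U i \<in> borel_measurable borel" for i using seq by simp
  have inc: "incseq (\<lambda>i. U i x)" for x
    using \<open>incseq U\<close> by (auto simp: incseq_def le_fun_def)
  have mono: "incseq (\<lambda>i. \<integral>\<^sup>+x. U i x \<partial>trunc_gaussian q)"
    using \<open>incseq U\<close> by (auto simp: incseq_def le_fun_def intro!: nn_integral_mono)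
  have *: "(\<integral>\<^sup>+x. (SUP i. U i x) \<partial>M) = (SUP i. \<integral>\<^sup>+x. U i x \<partial>M)"
    if "sets M = sets borel" for M :: "real measure"
    using that by (intro nn_integral_monotone_convergence_SUP \<open>incseq U\<close>) (auto cong: measurable_cong_sets)
  have cmult: "incseq (\<lambda>i. a * f i)" if "incseq f" for a :: ennreal and f
    using that by (auto simp: incseq_def intro!: mult_left_mono)
  have add: "incseq (\<lambda>i. f i + g i)" if "incseq f" "incseq g" for f g :: "nat \<Rightarrow> ennreal"
    using that by (auto simp: incseq_def intro!: add_mono)
  have "(\<integral>\<^sup>+x. (SUP i. U i x) \<partial>fbd_limit \<alpha> q)
      = (SUP i. ennreal (\<alpha> / 2) * U i (- q) + ennreal (1 - \<alpha>) * (\<integral>\<^sup>+x. U i x \<partial>trunc_gaussian q)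
          + ennreal (\<alpha> / 2) * U i q)"
    by (simp only: * sets_fbd_limit seq.IH)
  also have "\<dots> = ennreal (\<alpha> / 2) * (SUP i. U i (- q)) + ennreal (1 - \<alpha>) * (\<integral>\<^sup>+x. (SUP i. U i x) \<partial>trunc_gaussian q)
          + ennreal (\<alpha> / 2) * (SUP i. U i q)"
    unfolding *[OF sets_trunc_gaussian] SUP_mult_left_ennreal
    by (subst ennreal_SUP_add, intro add cmult inc mono, intro cmult inc)
      (subst ennreal_SUP_add, intro cmult inc, intro cmult mono, rule refl)
  finally show ?case by (simp only: SUP_apply image_image)
qed

lemma nn_integral_trunc_gaussian:
  assumes "q > 0" "continuous_on UNIV f" "\<And>x. 0 \<le> f x"
  shows "(\<integral>\<^sup>+x. ennreal (f x) \<partial>trunc_gaussian q)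
    = ennreal (integral {-q..q} (\<lambda>x. f x * std_normal_density x) / measure std_gaussian {-q..q})"
proof -
  let ?Z = "measure std_gaussian {-q..q}"
  have Z: "?Z > 0" by (rule measure_std_gaussian_pos[OF assms(1)])
  have [measurable]: "f \<in> borel_measurable borel"
    by (rule borel_measurable_continuous_onI[OF assms(2)])
  have "(\<integral>\<^sup>+x. ennreal (f x) \<partial>trunc_gaussian q)
      = (\<integral>\<^sup>+x. ennreal (f x * std_normal_density x / ?Z) * indicator {-q..q} x \<partial>lborel)"
    unfolding trunc_gaussian_def using Z assms(3)
    by (subst nn_integral_density)
      (auto intro!: nn_integral_cong simp: indicator_def ennreal_mult[symmetric] ac_simps)
  also have "\<dots> = ennreal (integral {-q..q} (\<lambda>x. f x * std_normal_density x) / ?Z)"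
    using Z assms
    by (intro nn_integral_has_integral_lebesgue' has_integral_divide integrable_integral
        integrable_times_std_normal_density continuous_on_subset[OF assms(2)]) auto
  finally show ?thesis .
qed

lemma integral_fbd_limit:
  assumes "0 < \<alpha>" "\<alpha> < 1" "q > 0" "continuous_on UNIV f" "\<And>x. 0 \<le> f x"
  shows "integral\<^sup>L (fbd_limit \<alpha> q) f = limit_expectation \<alpha> q f"
proof -
  have [measurable]: "f \<in> borel_measurable borel"
    by (rule borel_measurable_continuous_onI[OF assms(4)])
  define I where "I = integral {-q..q} (\<lambda>x. f x * std_normal_density x) / measure std_gaussian {-q..q}"
  have "0 \<le> I"
    unfolding I_def using assms continuous_on_subset[OF assms(4)]
    by (intro divide_nonneg_nonneg Henstock_Kurzweil_Integration.integral_nonneg integrable_times_std_normal_density) auto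
  then have nonneg: "0 \<le> \<alpha> / 2 * f (- q)" "0 \<le> (1 - \<alpha>) * I" "0 \<le> \<alpha> / 2 * f q"
    using assms by simp_all
  have "(\<integral>\<^sup>+x. ennreal (f x) \<partial>fbd_limit \<alpha> q)
      = ennreal (\<alpha> / 2) * ennreal (f (- q)) + ennreal (1 - \<alpha>) * ennreal I + ennreal (\<alpha> / 2) * ennreal (f q)"
    using assms by (simp add: nn_integral_fbd_limit nn_integral_trunc_gaussian I_def)
  also have "\<dots> = ennreal (\<alpha> / 2 * f (- q)) + ennreal ((1 - \<alpha>) * I) + ennreal (\<alpha> / 2 * f q)"
    using assms \<open>0 \<le> I\<close> by (simp only: ennreal_mult less_imp_le divide_nonneg_nonneg diff_ge_0_iff_ge zero_le_numeral)
  also have "\<dots> = ennreal (limit_expectation \<alpha> q f)"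
    using nonneg by (simp only: limit_expectation_def I_def ennreal_plus add_nonneg_nonneg)
  finally have "(\<integral>\<^sup>+x. ennreal (f x) \<partial>fbd_limit \<alpha> q) = ennreal (limit_expectation \<alpha> q f)" .
  moreover have "0 \<le> limit_expectation \<alpha> q f"
    using nonneg by (simp only: limit_expectation_def I_def add_nonneg_nonneg)
  ultimately show ?thesis
    using assms(5) by (subst integral_eq_nn_integral) auto
qed

lemma integral_fbd_rescaled:
  fixes f :: "real \<Rightarrow> real"
  assumes "0 < \<alpha>" "\<alpha> < 1" and [measurable]: "f \<in> borel_measurable borel"
  shows "integral\<^sup>L (fbd_rescaled \<alpha> t) f
    = (\<Sum>x=-int t..int t. fbd \<alpha> t x * f (real_of_int x / sqrt (real t)))"
proof -
  have m: "0 \<le> fbd \<alpha> t x" and z: "\<bar>x\<bar> > int t \<Longrightarrow> fbd \<alpha> t x = 0" for x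
    using sym_dist_fbd[OF assms(1,2), of t] by (auto simp: sym_dist_def)
  let ?g = "\<lambda>x. fbd \<alpha> t x * f (real_of_int x / sqrt (real t))"
  have sub: "{x. ?g x \<noteq> 0} \<subseteq> {-int t..int t}"
  proof
    fix x assume "x \<in> {x. ?g x \<noteq> 0}"
    then have "\<not> \<bar>x\<bar> > int t" using z by auto
    then show "x \<in> {-int t..int t}" by auto
  qed
  have "integral\<^sup>L (fbd_rescaled \<alpha> t) f
      = (\<integral>x. f (real_of_int x / sqrt (real t)) \<partial>fbd_measure \<alpha> t)"
    unfolding fbd_rescaled_def by (rule integral_distr) (auto simp: fbd_measure_def)
  also have "\<dots> = (\<integral>x. ?g x \<partial>count_space UNIV)"
    unfolding fbd_measure_def by (subst integral_density) (auto simp: m)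
  also have "\<dots> = (\<Sum>x | x \<in> UNIV \<and> ?g x \<noteq> 0. ?g x)"
    using finite_subset[OF sub] by (intro lebesgue_integral_count_space_finite_support) auto
  also have "\<dots> = (\<Sum>x=-int t..int t. ?g x)"
    using sub by (intro sum.mono_neutral_left) auto
  finally show ?thesis .
qed

section \<open>Identification of the limit\<close>

text \<open>
  Normalised by \<open>c ^ (2 * k)\<close>, the sequence satisfies \<open>p (k + 1) = (2 * k + 1) / c\<^sup>2 * p k + e\<close>. Being
  bounded it must tend to \<open>0\<close>, as the coefficient is unbounded. But it keeps the sign of \<open>e\<close> from the
  start, so the recursion also gives \<open>e * p (k + 1) \<ge> e\<^sup>2\<close> for all \<open>k\<close>.
\<close>

lemma bounded_recurrence_imp_no_forcing:
  fixes d :: "nat \<Rightarrow> real"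
  assumes c: "c > 0" and d0: "d 0 = 0"
    and rec: "\<And>k. d (Suc k) = (2 * real k + 1) * d k + e * c ^ (2 * Suc k)"
    and bound: "\<And>k. \<bar>d k\<bar> \<le> B * c ^ (2 * k)"
  shows "e = 0"
proof -
  define p where "p k = d k / c ^ (2 * k)" for k
  have prec: "p (Suc k) = (2 * real k + 1) / c\<^sup>2 * p k + e" for k
    using c by (simp add: p_def rec field_simps power2_eq_square)
  have pB: "\<bar>p k\<bar> \<le> B" for k
    using bound[of k] c by (simp add: p_def field_simps abs_mult)
  have "0 \<le> e * p k" for k
  proof (induction k)
    case (Suc k)
    have "e * p (Suc k) = (2 * real k + 1) / c\<^sup>2 * (e * p k) + e * e"
      unfolding prec by (simp add: algebra_simps)
    also have "\<dots> \<ge> 0" by (intro add_nonneg_nonneg mult_nonneg_nonneg[OF _ Suc] zero_le_square) simp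
    finally show ?case .
  qed (simp add: p_def d0)
  moreover have "e * p (Suc k) = (2 * real k + 1) / c\<^sup>2 * (e * p k) + e * e" for k
    unfolding prec by (simp add: algebra_simps)
  ultimately have lower: "e * e \<le> e * p (Suc k)" for k by simp
  have "\<bar>p k\<bar> \<le> (B + \<bar>e\<bar>) * c\<^sup>2 / (2 * real k + 1)" for k
  proof -
    have "(2 * real k + 1) / c\<^sup>2 * \<bar>p k\<bar> = \<bar>p (Suc k) - e\<bar>"
      unfolding prec by (simp add: abs_mult)
    also have "\<dots> \<le> B + \<bar>e\<bar>" using pB[of "Suc k"] by linarith
    finally show ?thesis using c by (simp add: field_simps)
  qed
  moreover have "(\<lambda>k. (B + \<bar>e\<bar>) * c\<^sup>2 / (2 * real k + 1)) \<longlonglongrightarrow> 0" by real_asymp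
  ultimately have "p \<longlonglongrightarrow> 0"
    by (intro Lim_null_comparison[of p]) (auto intro!: always_eventually)
  then have "(\<lambda>k. e * p (Suc k)) \<longlonglongrightarrow> e * 0" by (intro tendsto_intros LIMSEQ_Suc)
  then have "e * e \<le> e * 0" by (rule LIMSEQ_le_const) (auto simp: lower)
  then show ?thesis by (auto simp: mult_le_0_iff)
qed

context
  fixes \<alpha> c :: real
  assumes \<alpha>: "0 < \<alpha>" "\<alpha> < 1"
    and lim: "(\<lambda>t. real_of_int (fbd_boundary \<alpha> t) / sqrt (real t)) \<longlonglongrightarrow> c"
begin

text \<open>
  The defect \<open>e\<close> of the equation at \<open>c\<close> drives the recursion for the difference of the two moment
  sequences. Both are moments of measures on \<open>[-c, c]\<close> (in the limit), so the difference is at most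
  \<open>c ^ (2 * k)\<close>, which leaves no room for a defect.
\<close>

lemma limit_expectation_even: "limit_expectation \<alpha> c (\<lambda>x. x ^ (2 * k)) = limit_moment \<alpha> c k"
  and flux_balance:
    "\<alpha> = 2 * (1 - \<alpha>) * std_normal_density c / (c * measure std_gaussian {-c..c})"
proof -
  note c = boundary_limit_pos[OF \<alpha> lim]
  define e where "e = \<alpha> - 2 * (1 - \<alpha>) * std_normal_density c / (c * measure std_gaussian {-c..c})"
  define l where "l k = limit_expectation \<alpha> c (\<lambda>x. x ^ (2 * k))" for k
  have l_rec: "l (Suc k) = (2 * real k + 1) * (l k - \<alpha> * c ^ (2 * k)) + e * c ^ (2 * Suc k)" for k
    unfolding l_def e_def by (rule limit_expectation_even_rec[OF c])
  have l0: "l 0 = 1" by (simp add: l_def limit_expectation_const[OF c])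
  have bounds: "0 \<le> l k" "l k \<le> c ^ (2 * k)" for k
  proof -
    have "limit_expectation \<alpha> c (\<lambda>x. 0) \<le> l k" unfolding l_def
      by (intro limit_expectation_mono[OF c \<alpha>] continuous_intros) auto
    then show "0 \<le> l k" by (simp only: limit_expectation_const[OF c])
    have "l k \<le> limit_expectation \<alpha> c (\<lambda>x. c ^ (2 * k))" unfolding l_def
    proof (intro limit_expectation_mono[OF c \<alpha>] continuous_intros)
      fix x assume "x \<in> {-c..c}"
      then have "\<bar>x\<bar> ^ (2 * k) \<le> c ^ (2 * k)" by (intro power_mono) auto
      then show "x ^ (2 * k) \<le> c ^ (2 * k)" by (simp add: power_even_abs)
    qed
    then show "l k \<le> c ^ (2 * k)"
      by (simp only: limit_expectation_const[OF c])
  qed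
  have "e = 0"
  proof (rule bounded_recurrence_imp_no_forcing[OF c])
    fix k
    show "l (Suc k) - limit_moment \<alpha> c (Suc k)
        = (2 * real k + 1) * (l k - limit_moment \<alpha> c k) + e * c ^ (2 * Suc k)"
      unfolding l_rec limit_moment.simps by (simp add: algebra_simps)
    show "\<bar>l k - limit_moment \<alpha> c k\<bar> \<le> 1 * c ^ (2 * k)"
      using bounds[of k] limit_moment_bounds[OF \<alpha> lim, of k] by linarith
  qed (simp add: l0)
  then show "\<alpha> = 2 * (1 - \<alpha>) * std_normal_density c / (c * measure std_gaussian {-c..c})"
    by (simp add: e_def)
  show "limit_expectation \<alpha> c (\<lambda>x. x ^ (2 * k)) = limit_moment \<alpha> c k"
    unfolding l_def[symmetric] using \<open>e = 0\<close> by (induction k) (simp_all add: l0 l_rec)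
qed

private abbreviation (input) "rescaled_sum t f \<equiv> \<Sum>x=-int t..int t. fbd \<alpha> t x * f (real_of_int x / sqrt (real t))"

lemma rescaled_moment_limit:
  "(\<lambda>t. rescaled_sum t (\<lambda>x. x ^ n)) \<longlonglongrightarrow> limit_expectation \<alpha> c (\<lambda>x. x ^ n)"
proof -
  have eq: "rescaled_sum t (\<lambda>x. x ^ n) = fbd_moment \<alpha> n t / sqrt (real t) ^ n" for t
    by (simp add: fbd_moment_def power_divide sum_divide_distrib)
  show ?thesis
  proof (cases "even n")
    case True
    then obtain k where n: "n = 2 * k" by blast
    show ?thesis
      unfolding eq unfolding n using fbd_moment_even_limit[OF \<alpha> lim, of k]
      by (simp only: sqrt_power_even limit_expectation_even)
  next
    case False
    then show ?thesis
      by (simp add: eq fbd_moment_odd[OF \<alpha>] limit_expectation_odd)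
  qed
qed

lemma rescaled_polynomial_limit:
  assumes "real_polynomial_function p"
  shows "(\<lambda>t. rescaled_sum t p) \<longlonglongrightarrow> limit_expectation \<alpha> c p"
proof -
  obtain a N where p: "p = (\<lambda>x. \<Sum>i\<le>N. a i * x ^ i)"
    using assms by (auto simp: real_polynomial_function_iff_sum)
  have "(\<lambda>t. rescaled_sum t (\<lambda>x. \<Sum>i\<le>N. a i * x ^ i))
      \<longlonglongrightarrow> limit_expectation \<alpha> c (\<lambda>x. \<Sum>i\<le>N. a i * x ^ i)"
  proof (induction N)
    case 0
    show ?case
      using tendsto_mult_left[OF rescaled_moment_limit[of 0], of "a 0"]
      by (simp only: atMost_0 sum.insert finite.emptyI empty_iff not_False_eq_True sum.empty add_0_right
          limit_expectation_cmult sum_distrib_left mult.left_commute[of _ "a 0"])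
  next
    case (Suc N)
    have "limit_expectation \<alpha> c (\<lambda>x. (\<Sum>i\<le>N. a i * x ^ i) + a (Suc N) * x ^ Suc N)
        = limit_expectation \<alpha> c (\<lambda>x. \<Sum>i\<le>N. a i * x ^ i) + a (Suc N) * limit_expectation \<alpha> c (\<lambda>x. x ^ Suc N)"
      unfolding limit_expectation_cmult[symmetric]
      by (intro limit_expectation_add continuous_intros)
    then show ?case
      using tendsto_add[OF Suc tendsto_mult_left[OF rescaled_moment_limit[of "Suc N"], of "a (Suc N)"]]
      by (simp only: sum.atMost_Suc distrib_left sum.distrib sum_distrib_left mult.left_commute[of _ "a (Suc N)"])
  qed
  then show ?thesis by (simp only: p)
qed

text \<open>
  For large \<open>t\<close> the rescaled measures live on \<open>[-(c + 1), c + 1]\<close>, where polynomials are uniformly dense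
  in the continuous functions.
\<close>

lemma rescaled_continuous_limit:
  assumes f: "continuous_on UNIV f"
  shows "(\<lambda>t. rescaled_sum t f) \<longlonglongrightarrow> limit_expectation \<alpha> c f"
proof (rule LIMSEQ_I)
  fix e :: real assume e: "e > 0"
  note c = boundary_limit_pos[OF \<alpha> lim]
  have "continuous_on {-(c+1)..c+1} f" using f by (rule continuous_on_subset) simp
  then obtain p where p: "real_polynomial_function p"
    and close: "\<And>x. x \<in> {-(c+1)..c+1} \<Longrightarrow> \<bar>f x - p x\<bar> < e / 3"
    using Stone_Weierstrass_real_polynomial_function[of "{-(c+1)..c+1}" f "e/3"] e by auto
  have contp: "continuous_on {-c..c} p"
    using p by (intro continuous_on_polymonial_function real_polynomial_function_eq[THEN iffD1])
  have contf: "continuous_on {-c..c} f" using f by (rule continuous_on_subset) simp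
  have near: "f x \<le> p x + e / 3" "p x \<le> f x + e / 3" if "x \<in> {-c..c}" for x
  proof -
    have "\<bar>f x - p x\<bar> < e / 3" using that by (intro close) auto
    then show "f x \<le> p x + e / 3" "p x \<le> f x + e / 3" by linarith+
  qed
  have "limit_expectation \<alpha> c f \<le> limit_expectation \<alpha> c (\<lambda>x. p x + e / 3)"
    by (intro limit_expectation_mono[OF c \<alpha>] continuous_intros contp contf near)
  also have "\<dots> = limit_expectation \<alpha> c p + e / 3"
    by (rule limit_expectation_add_const[OF c contp])
  finally have up: "limit_expectation \<alpha> c f \<le> limit_expectation \<alpha> c p + e / 3" .
  have "limit_expectation \<alpha> c p \<le> limit_expectation \<alpha> c (\<lambda>x. f x + e / 3)"
    by (intro limit_expectation_mono[OF c \<alpha>] continuous_intros contp contf near)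
  also have "\<dots> = limit_expectation \<alpha> c f + e / 3"
    by (rule limit_expectation_add_const[OF c contf])
  finally have lo: "limit_expectation \<alpha> c p \<le> limit_expectation \<alpha> c f + e / 3" .
  have "eventually (\<lambda>t. (real_of_int (fbd_boundary \<alpha> t) + 1) / sqrt (real t) < c + 1) sequentially"
    using front_limit[OF \<alpha> lim] by (rule order_tendstoD) simp
  moreover have "eventually (\<lambda>t. \<bar>rescaled_sum t p - limit_expectation \<alpha> c p\<bar> < e / 3) sequentially"
    using tendstoD[OF rescaled_polynomial_limit[OF p], of "e / 3"] e by (simp add: dist_real_def)
  ultimately have "eventually (\<lambda>t. norm (rescaled_sum t f - limit_expectation \<alpha> c f) < e) sequentially"
  proof eventually_elim
    case (elim t)
    have m: "0 \<le> fbd \<alpha> t x" for x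
      using sym_dist_fbd[OF \<alpha>, of t] by (simp add: sym_dist_def)
    have "\<bar>rescaled_sum t f - rescaled_sum t p\<bar>
        = \<bar>\<Sum>x=-int t..int t. fbd \<alpha> t x * (f (real_of_int x / sqrt (real t)) - p (real_of_int x / sqrt (real t)))\<bar>"
      by (simp add: sum_subtractf right_diff_distrib)
    also have "\<dots> \<le> (\<Sum>x=-int t..int t. \<bar>fbd \<alpha> t x * (f (real_of_int x / sqrt (real t)) - p (real_of_int x / sqrt (real t)))\<bar>)"
      by (rule sum_abs)
    also have "\<dots> \<le> (\<Sum>x=-int t..int t. fbd \<alpha> t x * (e / 3))"
    proof (rule sum_mono)
      fix x
      let ?y = "real_of_int x / sqrt (real t)"
      show "\<bar>fbd \<alpha> t x * (f ?y - p ?y)\<bar> \<le> fbd \<alpha> t x * (e / 3)"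
      proof (cases "fbd \<alpha> t x = 0")
        case False
        have "\<bar>?y\<bar> = \<bar>real_of_int x\<bar> / sqrt (real t)" by simp
        also have "\<dots> \<le> (real_of_int (fbd_boundary \<alpha> t) + 1) / sqrt (real t)"
          using abs_le_front[OF \<alpha> False] by (intro divide_right_mono) auto
        finally have "\<bar>?y\<bar> < c + 1" using elim(1) by linarith
        then have "?y \<in> {-(c+1)..c+1}" by (simp only: atLeastAtMost_iff) linarith
        then have "\<bar>f ?y - p ?y\<bar> \<le> e / 3" using close by (auto intro: less_imp_le)
        then show ?thesis using m[of x] by (simp add: abs_mult mult_left_mono del: times_divide_eq_right)
      qed simp
    qed
    also have "\<dots> = e / 3"
      using sym_dist_fbd[OF \<alpha>, of t] by (simp only: sum_distrib_right[symmetric] sym_dist_def mult_1_left)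
    finally show ?case using elim(2) up lo by (simp only: real_norm_def)
  qed
  then show "\<exists>no. \<forall>t\<ge>no. norm (rescaled_sum t f - limit_expectation \<alpha> c f) < e"
    by (simp add: eventually_sequentially)
qed

lemma fbd_rescaled_weak_limit: "weak_conv_m (fbd_rescaled \<alpha>) (fbd_limit \<alpha> c)"
proof (rule integral_cts_step_conv_imp_weak_conv)
  note c = boundary_limit_pos[OF \<alpha> lim]
  show "real_distribution (fbd_rescaled \<alpha> t)" for t by (rule real_distribution_fbd_rescaled[OF \<alpha>])
  show "real_distribution (fbd_limit \<alpha> c)" by (rule real_distribution_fbd_limit[OF \<alpha> c])
  fix x y :: real assume "x < y"
  then have cont: "continuous_on UNIV (cts_step x y)"
    by (intro uniformly_continuous_imp_continuous cts_step_uniformly_continuous)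
  have nonneg: "0 \<le> cts_step x y z" for z using \<open>x < y\<close> by (auto simp: cts_step_def)
  show "(\<lambda>t. integral\<^sup>L (fbd_rescaled \<alpha> t) (cts_step x y)) \<longlonglongrightarrow> integral\<^sup>L (fbd_limit \<alpha> c) (cts_step x y)"
    unfolding integral_fbd_limit[OF \<alpha> c cont nonneg]
      integral_fbd_rescaled[OF \<alpha> borel_measurable_continuous_onI[OF cont]]
    by (rule rescaled_continuous_limit[OF cont])
qed

end

text \<open>
  The left-hand side of the equation increases strictly in \<open>q\<close>, the right-hand side decreases. The
  conclusion is an inequality so that applying it in both directions gives equality.
\<close>

lemma flux_equation_solutions_le:
  fixes \<alpha> p q :: real
  assumes "0 < \<alpha>" "\<alpha> < 1" "0 < p" "0 < q"
    and p: "\<alpha> / 2 * p = (1 - \<alpha>) * exp (- p\<^sup>2 / 2) / (sqrt (2 * pi) * measure std_gaussian {-p..p})"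
    and q: "\<alpha> / 2 * q = (1 - \<alpha>) * exp (- q\<^sup>2 / 2) / (sqrt (2 * pi) * measure std_gaussian {-q..q})"
  shows "p \<le> q"
proof (rule ccontr)
  interpret prob_space std_gaussian by (rule prob_space_std_gaussian)
  assume "\<not> p \<le> q"
  then have "q < p" by simp
  have "measure std_gaussian {-q..q} \<le> measure std_gaussian {-p..p}"
    using \<open>q < p\<close> by (intro finite_measure_mono) auto
  moreover have "exp (- p\<^sup>2 / 2) \<le> exp (- q\<^sup>2 / 2)"
    using \<open>q < p\<close> assms(4) by (simp add: power_mono)
  ultimately have "(1 - \<alpha>) * exp (- p\<^sup>2 / 2) / (sqrt (2 * pi) * measure std_gaussian {-p..p})
      \<le> (1 - \<alpha>) * exp (- q\<^sup>2 / 2) / (sqrt (2 * pi) * measure std_gaussian {-q..q})"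
    using assms(1,2) measure_std_gaussian_pos[OF assms(4)]
    by (intro frac_le mult_left_mono mult_pos_pos) auto
  then have "\<alpha> / 2 * p \<le> \<alpha> / 2 * q" using p q by simp
  then show False using \<open>q < p\<close> assms(1) by simp
qed

theorem theorem2:
  fixes \<alpha> :: real
  assumes "0 < \<alpha>" and "\<alpha> < 1"
    and "convergent (\<lambda>t. real_of_int (fbd_boundary \<alpha> t) / sqrt (real t))"
  shows "\<exists>q. (0 < q \<and> \<alpha> / 2 * q
                = (1 - \<alpha>) * exp (- q\<^sup>2 / 2) / (sqrt (2 * pi) * measure std_gaussian {-q..q}))
           \<and> (\<forall>q'. 0 < q' \<and> \<alpha> / 2 * q'
                = (1 - \<alpha>) * exp (- q'\<^sup>2 / 2) / (sqrt (2 * pi) * measure std_gaussian {-q'..q'})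
                \<longrightarrow> q' = q)
           \<and> weak_conv_m (fbd_rescaled \<alpha>) (fbd_limit \<alpha> q)"
proof -
  obtain c where lim: "(\<lambda>t. real_of_int (fbd_boundary \<alpha> t) / sqrt (real t)) \<longlonglongrightarrow> c"
    using assms(3) by (auto simp: convergent_def)
  note c = boundary_limit_pos[OF assms(1,2) lim]
  have "\<alpha> / 2 * c = (2 * (1 - \<alpha>) * std_normal_density c / (c * measure std_gaussian {-c..c})) / 2 * c"
    using flux_balance[OF assms(1,2) lim] by (rule arg_cong[where f = "\<lambda>a. a / 2 * c"])
  also have "\<dots> = (1 - \<alpha>) * exp (- c\<^sup>2 / 2) / (sqrt (2 * pi) * measure std_gaussian {-c..c})"
  proof -
    have "2 * (1 - \<alpha>) * (1 / s * E) / (c * Z) / 2 * c = (1 - \<alpha>) * E / (s * Z)"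
      if "s > 0" "Z > 0" for s E Z :: real
      using c that by (simp add: field_simps)
    from this[OF _ measure_std_gaussian_pos[OF c]] show ?thesis
      unfolding std_normal_density_def by simp
  qed
  finally have eq: "\<alpha> / 2 * c = (1 - \<alpha>) * exp (- c\<^sup>2 / 2) / (sqrt (2 * pi) * measure std_gaussian {-c..c})" .
  show ?thesis
  proof (intro exI[of _ c] conjI allI impI)
    fix q'
    assume "0 < q' \<and> \<alpha> / 2 * q'
        = (1 - \<alpha>) * exp (- q'\<^sup>2 / 2) / (sqrt (2 * pi) * measure std_gaussian {-q'..q'})"
    then have q': "0 < q'" "\<alpha> / 2 * q'
        = (1 - \<alpha>) * exp (- q'\<^sup>2 / 2) / (sqrt (2 * pi) * measure std_gaussian {-q'..q'})"
      by blast+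
    show "q' = c"
    proof (rule antisym)
      show "q' \<le> c" by (rule flux_equation_solutions_le[OF assms(1,2) q'(1) c q'(2) eq])
      show "c \<le> q'" by (rule flux_equation_solutions_le[OF assms(1,2) c q'(1) eq q'(2)])
    qed
  qed (fact c eq fbd_rescaled_weak_limit[OF assms(1,2) lim])+
qed

end
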